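(* Let $\mathcal C = \{a_j \pmod{m_j} : 1 \le j \le s\}$ be a finite distinct covering system of the integers for which $\Delta = \Delta(\mathcal C) \in (0, 1/12)$. Then $$\sum_{j=1}^{s} \frac{1}{m_j} \;\ge\; 1 + \exp\big(-(5.846 \cdot 10^{20} - 1.242 \cdot 10^{19} \cdot \log \Delta)/\Delta\big).$$
   Context: A covering system of the integers is a set $\mathcal C = \{a_j \pmod{m_j}\}$ of congruence classes (with $a_j \in \mathbb Z$ and moduli $m_j$ positive integers) such that every integer $x$ satisfies at least one of the congruences $x \equiv a_j \pmod{m_j}$. It is finite if it consists of finitely many congruence classes, and distinct if the moduli $m_j$ are pairwise distinct. A positive integer is $3$-smooth if it is divisible by no prime other than $2$ and $3$. For a finite distinct covering system $\mathcal C$, let $\mathcal C_3$ denote the set of congruences in $\mathcal C$ whose moduli are $3$-smooth, and define $$\Delta(\mathcal C) = \lim_{x \to \infty} \frac{\big|\{ n \in \mathbb Z : |n| \le x \text{ and } n \text{ does not satisfy any congruence in } \mathcal C_3 \}\big|}{2x}$$ (this limit always exists). Here $\log$ is the natural logarithm. *)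

theory Defs
  imports Complex_Main "HOL-Number_Theory.Cong"
begin

text \<open>
  The pair \<open>(a, m)\<close> stands for the congruence class \<open>a (mod m)\<close>. A class with \<open>m > 0\<close> is
  represented by several pairs, but two representatives of the same class share the modulus,
  so in a system satisfying \<open>distinct_moduli\<close> every class occurs as exactly one pair.
\<close>

type_synonym congruence = "int \<times> nat"

definition satisfies :: "int \<Rightarrow> congruence \<Rightarrow> bool" where
  "satisfies x c \<longleftrightarrow> [x = fst c] (mod int (snd c))"

definition covering_system :: "congruence set \<Rightarrow> bool" where
  "covering_system C \<longleftrightarrow> (\<forall>c\<in>C. snd c > 0) \<and> (\<forall>x. \<exists>c\<in>C. satisfies x c)"

definition distinct_moduli :: "congruence set \<Rightarrow> bool" where
  "distinct_moduli C \<longleftrightarrow> inj_on snd C"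

definition three_smooth :: "nat \<Rightarrow> bool" where
  "three_smooth n \<longleftrightarrow> n > 0 \<and> (\<forall>p. prime p \<and> p dvd n \<longrightarrow> p = 2 \<or> p = 3)"

definition three_smooth_part :: "congruence set \<Rightarrow> congruence set" where
  "three_smooth_part C = {c \<in> C. three_smooth (snd c)}"

text \<open>
  For finite \<open>C\<close> with positive moduli the set of uncovered integers is periodic, so the limit
  exists and \<open>Lim\<close> denotes it.
\<close>

definition uncovered_density :: "congruence set \<Rightarrow> real" where
  "uncovered_density C =
     Lim at_top (\<lambda>x::real.
       real (card {n::int. \<bar>real_of_int n\<bar> \<le> x \<and>
                           \<not> (\<exists>c\<in>three_smooth_part C. satisfies n c)}) / (2 * x))"

end

theory Submission
  imports Defs "HOL-Number_Theory.Number_Theory"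
begin

text \<open>
  Let \<open>K\<close> be about \<open>2 * 10 ^ 10 / sqrt \<Delta>\<close> and suppose that the reciprocal sum is below
  \<open>1 + 2 ^ (- 2 * K * K)\<close>. Two classes with moduli \<open>m\<close> and \<open>n\<close> that meet push the reciprocal sum
  of a covering above \<open>1 + 1 / (m * n)\<close>, so the classes with moduli up to \<open>2 ^ (K * K)\<close> are pairwise
  disjoint. This limits what moduli with new prime factors can cover. Write such a modulus as
  \<open>m = k * r\<close>, where \<open>k\<close> consists of the old primes and \<open>r\<close> of the new ones. The class modulo \<open>k\<close>
  that contains the class modulo \<open>m\<close> avoids everything covered with old primes only, and the
  numbers \<open>r\<close> occurring above a given integer pairwise share a prime. Classes to distinct
  moduli \<open>k\<close> satisfy \<open>\<Sum> 1 / k \<le> (\<Prod> p / (p - 1)) * density of their union\<close>, the product being over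
  the old primes; hence the newly covered density is at most a fixed fraction of the density that was
  still uncovered. For a single new prime \<open>p \<ge> 5\<close> this fraction is at most \<open>3 / 4\<close> and decays like
  a power of \<open>log p\<close> divided by \<open>p\<close>; for all primes between a power of \<open>K\<close> and \<open>2 ^ K\<close>
  together it is at most \<open>1 / 2\<close>. So the classes to \<open>2 ^ K\<close>-smooth moduli leave out a set of density at
  least \<open>exp (- K / 6)\<close>, say, and by the distortion method of Balister, Bollobas, Morris,
  Sahasrabudhe and Tiba the remaining moduli cannot cover a set of that density.
\<close>

section \<open>Averages of periodic functions\<close>

text \<open>The threshold \<open>2 ^ (K * K)\<close> balances two demands. Disjointness of the
  classes up to a bound \<open>B\<close> costs \<open>1 / (B * B)\<close> in the reciprocal sum,
  while the \<open>2 ^ K\<close>-smooth moduli beyond \<open>B\<close> must have a reciprocal sum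
  far below the density that is kept; Rankin's trick provides this for
  \<open>B = 2 ^ (K * K)\<close>. The claim leaves room for \<open>K * K\<close> of order
  \<open>1 / \<Delta>\<close>, and the initial density \<open>\<Delta> \<ge> 1 / K ^ 2\<close> is
  large compared with \<open>2 ^ (- K)\<close>. The obstacle is the range of primes up to
  \<open>2 ^ K\<close>. One prime at a time, it would cost a factor like
  \<open>exp (- (K ^ 3 * ln K))\<close>, far less than the roughly \<open>2 ^ (- K)\<close> that the
  distortion method can still handle. All at once, the small primes make the bound for the loss
  exceed 1. Hence the cut at \<open>2 ^ k\<close> with \<open>2 ^ k \<ge> 8 * K ^ 5\<close>: below
  it, \<open>k\<close> is logarithmic in \<open>K\<close> and single primes cost no more than
  \<open>exp (- 7 * k ^ 4)\<close>; above it, a modulus up to \<open>2 ^ (K * K)\<close> has at most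
  \<open>K * K\<close> new primes, all so large that the joint loss is at most
  \<open>1 / 2\<close>.\<close>

definition avg :: "nat \<Rightarrow> (int \<Rightarrow> real) \<Rightarrow> real" where
  "avg N f = (\<Sum>x<N. f (int x)) / real N"

definition periodic :: "nat \<Rightarrow> (int \<Rightarrow> 'a) \<Rightarrow> bool" where
  "periodic N f \<longleftrightarrow> (\<forall>x y. [x = y] (mod int N) \<longrightarrow> f x = f y)"

lemma periodicD: "periodic N f \<Longrightarrow> [x = y] (mod int N) \<Longrightarrow> f x = f y"
  unfolding periodic_def by blast

lemma periodic_dvd: "periodic A f \<Longrightarrow> A dvd N \<Longrightarrow> periodic N f"
  unfolding periodic_def by (meson cong_dvd_modulus of_nat_dvd_iff)

lemma avg_mono: "(\<And>x. f x \<le> g x) \<Longrightarrow> avg N f \<le> avg N g"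
  unfolding avg_def by (intro divide_right_mono sum_mono) auto

lemma avg_add: "avg N (\<lambda>x. f x + g x) = avg N f + avg N g"
  by (simp add: avg_def sum.distrib add_divide_distrib)

lemma avg_diff: "avg N (\<lambda>x. f x - g x) = avg N f - avg N g"
  by (simp add: avg_def sum_subtractf diff_divide_distrib)

lemma avg_cmult: "avg N (\<lambda>x. c * f x) = c * avg N f"
  by (simp add: avg_def sum_distrib_left)

lemma avg_sum: "avg N (\<lambda>x. \<Sum>i\<in>I. f i x) = (\<Sum>i\<in>I. avg N (f i))"
  unfolding avg_def by (subst sum.swap) (simp add: sum_divide_distrib)

lemma avg_const: "N > 0 \<Longrightarrow> avg N (\<lambda>x. c) = c"
  by (simp add: avg_def)

lemma avg_nonneg: "(\<And>x. f x \<ge> 0) \<Longrightarrow> avg N f \<ge> 0"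
  by (simp add: avg_def sum_nonneg)

lemma avg_of_bool_le_1: "avg N (\<lambda>x. of_bool (P x)) \<le> 1"
proof (cases "N = 0")
  case False
  then show ?thesis using avg_mono[of "\<lambda>x. of_bool (P x)" "\<lambda>_. 1" N] avg_const[of N 1] by simp
qed (simp add: avg_def)

lemma avg_pos_witness: "avg N f > 0 \<Longrightarrow> \<exists>x. f x > 0"
  unfolding avg_def by (metis divide_nonpos_nonneg linorder_not_le of_nat_0_le_iff sum_nonpos)

text \<open>Cuts \<open>0, ..., A * B - 1\<close> into \<open>B\<close> blocks of length
  \<open>A\<close>. The inner average runs along the residue class of \<open>x\<close> modulo
  \<open>A\<close>; \<open>distinct_classes_sum_le\<close> and \<open>distortion_step\<close> slice
  the integers this way.\<close>

lemma avg_mult: "avg (A * B) f = avg A (\<lambda>x. avg B (\<lambda>y. f (x + int A * y)))"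
proof -
  have "(\<Sum>x<A*B. f (int x)) = (\<Sum>y<B. \<Sum>x<A. f (int x + int A * int y))"
  proof -
    have "(\<Sum>x<A*B. f (int x)) = (\<Sum>y<B. sum (\<lambda>x. f (int x)) {y*A..<y*A+A})"
      by (subst sum.nat_group) (simp add: mult.commute)
    also have "\<dots> = (\<Sum>y<B. \<Sum>x<A. f (int x + int A * int y))"
    proof (rule sum.cong[OF refl])
      fix y
      have "sum (\<lambda>x. f (int x)) {y*A..<y*A+A} = sum (\<lambda>x. f (int (x + y*A))) {0..<A}"
        using sum.shift_bounds_nat_ivl[of "\<lambda>x. f (int x)" 0 "y*A" A] by (simp add: add.commute)
      then show "sum (\<lambda>x. f (int x)) {y*A..<y*A+A} = (\<Sum>x<A. f (int x + int A * int y))"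
        by (simp add: atLeast0LessThan mult.commute)
    qed
    finally show ?thesis .
  qed
  also have "\<dots> = (\<Sum>x<A. \<Sum>y<B. f (int x + int A * int y))" by (rule sum.swap)
  finally show ?thesis by (simp add: avg_def sum_divide_distrib mult.commute)
qed

lemma avg_dvd:
  assumes "periodic A f" "A dvd N" "N > 0"
  shows "avg N f = avg A f"
proof -
  obtain B where B: "N = A * B" using assms by blast
  have "f (x + int A * y) = f x" for x y
    by (rule periodicD[OF assms(1)]) (simp add: cong_def)
  then have "avg N f = avg A (\<lambda>x. avg B (\<lambda>y. f x))" unfolding B avg_mult by simp
  then show ?thesis using assms B by (simp add: avg_const)
qed

lemma periodic_class: "periodic m (\<lambda>x. [x = a] (mod int m))"
  unfolding periodic_def by (meson cong_sym cong_trans)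

lemma periodic_comp: "periodic N f \<Longrightarrow> periodic N (\<lambda>x. g (f x))"
  unfolding periodic_def by metis

lemma periodic_Ex_class:
  assumes "\<And>k. k \<in> D \<Longrightarrow> m k dvd N"
  shows "periodic N (\<lambda>x. \<exists>k\<in>D. [x = b k] (mod int (m k)))"
proof -
  have *: "(\<exists>k\<in>D. [x = b k] (mod int (m k))) \<Longrightarrow> (\<exists>k\<in>D. [y = b k] (mod int (m k)))"
    if xy: "[x = y] (mod int N)" for x y
  proof (elim bexE)
    fix k assume k: "k \<in> D" "[x = b k] (mod int (m k))"
    have "[x = y] (mod int (m k))" using xy cong_dvd_modulus assms[OF k(1)] of_nat_dvd_iff by blast
    then show "\<exists>k\<in>D. [y = b k] (mod int (m k))" using k by (meson cong_sym cong_trans)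
  qed
  show ?thesis unfolding periodic_def using * cong_sym by blast
qed

lemma avg_class_self:
  assumes "m > 0"
  shows "avg m (\<lambda>x. of_bool ([x = a] (mod int m))) = 1 / real m"
proof -
  define r where "r = nat (a mod int m)"
  have r: "r < m" "int r = a mod int m" using assms by (auto simp: r_def nat_less_iff)
  have "[int x = a] (mod int m) \<longleftrightarrow> x = r" if "x < m" for x
    unfolding cong_def r(2)[symmetric] using that r(1) by simp
  then have "(\<Sum>x<m. of_bool ([int x = a] (mod int m)) :: real) = (\<Sum>x<m. of_bool (x = r))"
    by (intro sum.cong) auto
  also have "\<dots> = 1" using r(1) by (simp add: of_bool_def sum.delta)
  finally show ?thesis by (simp add: avg_def)
qed

lemma avg_class:
  assumes "m dvd N" "N > 0"
  shows "avg N (\<lambda>x. of_bool ([x = a] (mod int m))) = 1 / real m"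
proof -
  have "m > 0" using assms by (metis dvd_0_left_iff gr0I less_irrefl)
  then show ?thesis
    using avg_dvd[OF periodic_comp[OF periodic_class] assms] avg_class_self[of m] by simp
qed

section \<open>Natural density of a periodic set\<close>

lemma avg_shift:
  assumes gP: "periodic N g" and "N > 0"
  shows "avg N (\<lambda>x. g (v + x)) = avg N g"
proof -
  have "bij_betw (\<lambda>i. nat ((v + int i) mod int N)) {..<N} {..<N}"
  proof (rule bij_betwI[where g="\<lambda>j. nat ((int j - v) mod int N)"])
    show "(\<lambda>i. nat ((v + int i) mod int N)) \<in> {..<N} \<rightarrow> {..<N}" using \<open>N > 0\<close> by (auto simp: nat_less_iff)
    show "(\<lambda>j. nat ((int j - v) mod int N)) \<in> {..<N} \<rightarrow> {..<N}" using \<open>N > 0\<close> by (auto simp: nat_less_iff)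
  qed (use \<open>N > 0\<close> in \<open>auto simp: mod_simps\<close>)
  then have "(\<Sum>i<N. g (int (nat ((v + int i) mod int N)))) = (\<Sum>i<N. g (int i))"
    by (rule sum.reindex_bij_betw)
  moreover have "g (int (nat ((v + int i) mod int N))) = g (v + int i)" for i
    by (rule periodicD[OF gP]) (use \<open>N > 0\<close> in \<open>auto simp: cong_def\<close>)
  ultimately show ?thesis unfolding avg_def by (simp only:)
qed

text \<open>A window of length \<open>L\<close> contains \<open>L div N\<close> full periods and
  fits into one more; each full period contributes exactly its average, wherever it starts.\<close>

lemma card_window:
  assumes P: "periodic N P" and "N > 0"
  shows "\<bar>real (card {n. u \<le> n \<and> n < u + int L \<and> P n}) - real L * avg N (\<lambda>x. of_bool (P x))\<bar> \<le> real N"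
proof -
  define g :: "int \<Rightarrow> real" where "g = (\<lambda>x. of_bool (P x))"
  have gP: "periodic N g" unfolding g_def by (rule periodic_comp[OF P])
  define s where "s = nat (u mod int N)"
  have gs: "g (u + x) = g (int s + x)" for x
    by (rule periodicD[OF gP]) (use \<open>N > 0\<close> in \<open>auto simp: s_def cong_def mod_simps\<close>)
  have card: "real (card {n. u \<le> n \<and> n < u + int L \<and> P n}) = (\<Sum>i<L. g (u + int i))" for L
  proof -
    have "{n. u \<le> n \<and> n < u + int L \<and> P n} = (\<lambda>i. u + int i) ` {i\<in>{..<L}. P (u + int i)}"
    proof (intro equalityI subsetI)
      fix n assume n: "n \<in> {n. u \<le> n \<and> n < u + int L \<and> P n}"
      then have "n = u + int (nat (n - u))" "nat (n - u) < L" by auto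
      then show "n \<in> (\<lambda>i. u + int i) ` {i\<in>{..<L}. P (u + int i)}" using n
        by (intro image_eqI[of _ _ "nat (n - u)"]) auto
    qed auto
    then have "card {n. u \<le> n \<and> n < u + int L \<and> P n} = card {i\<in>{..<L}. P (u + int i)}"
      by (simp add: card_image inj_on_def)
    then show ?thesis by (simp add: g_def sum.If_cases of_bool_def Int_def)
  qed
  have full: "(\<Sum>i<N*q. g (u + int i)) = real (N*q) * avg N g" for q
  proof -
    have block: "(\<Sum>i<N. g (v + int i)) = real N * avg N g" for v
      using avg_shift[OF gP \<open>N > 0\<close>, of v] \<open>N > 0\<close> by (simp add: avg_def)
    show ?thesis
    proof (induction q)
      case (Suc q)
      have "(\<Sum>i<N * Suc q. g (u + int i)) = (\<Sum>i<N*q. g (u + int i)) + (\<Sum>i<N. g (u + int (N*q) + int i))"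
        using sum.nat_group[of "\<lambda>i. g (u + int i)" N "Suc q"] sum.nat_group[of "\<lambda>i. g (u + int i)" N q]
          sum.shift_bounds_nat_ivl[of "\<lambda>i. g (u + int i)" 0 "q*N" N]
        by (simp add: mult.commute add.commute atLeast0LessThan algebra_simps)
      then show ?case using Suc block[of "u + int (N*q)"] by (simp add: algebra_simps)
    qed simp
  qed
  define q where "q = L div N"
  have L1: "N*q \<le> L" and L2: "L < N*q + N"
    using \<open>N > 0\<close> by (auto simp: q_def) (metis add.commute add_less_cancel_left div_mod_decomp mod_less_divisor mult.commute)
  have g01: "0 \<le> g x" "g x \<le> 1" for x by (auto simp: g_def)
  have a01: "0 \<le> avg N g" "avg N g \<le> 1" unfolding g_def by (auto intro: avg_nonneg avg_of_bool_le_1)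
  have le: "(\<Sum>i<N*q. g (u + int i)) \<le> (\<Sum>i<L. g (u + int i))"
    by (rule sum_mono2) (use L1 g01 in auto)
  have ge: "(\<Sum>i<L. g (u + int i)) \<le> (\<Sum>i<N*Suc q. g (u + int i))"
    by (rule sum_mono2) (use L2 g01 in auto)
  have "real (N*q) * avg N g \<le> real L * avg N g" "real L * avg N g \<le> real (N*Suc q) * avg N g"
    using L1 L2 a01 by (auto intro!: mult_right_mono simp del: of_nat_mult)
  moreover have "real (N*Suc q) * avg N g - real (N*q) * avg N g \<le> real N"
    using a01 by (simp add: algebra_simps mult_left_le)
  ultimately show ?thesis using le ge full[of q] full[of "Suc q"] card[of L]
    unfolding g_def[symmetric] by linarith
qed

text \<open>The integers with \<open>\<bar>n\<bar> \<le> x\<close> form a window of length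
  \<open>2 * \<lfloor>x\<rfloor> + 1\<close>. Counting in it is off by at most \<open>N\<close>,
  replacing its length by \<open>2 * x\<close> costs at most 1 more, so the quotient deviates by at
  most \<open>(N + 1) / (2 * x)\<close>.\<close>

lemma density_eq_avg:
  assumes P: "periodic N P" and "N > 0"
  shows "Lim at_top (\<lambda>x::real. real (card {n::int. \<bar>real_of_int n\<bar> \<le> x \<and> P n}) / (2 * x))
    = avg N (\<lambda>x. of_bool (P x))"
proof (rule tendsto_Lim)
  let ?A = "avg N (\<lambda>x. of_bool (P x))"
  let ?f = "\<lambda>x::real. real (card {n::int. \<bar>real_of_int n\<bar> \<le> x \<and> P n}) / (2 * x)"
  have a01: "0 \<le> ?A" "?A \<le> 1" by (auto intro: avg_nonneg avg_of_bool_le_1)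
  have bound: "\<bar>?f x - ?A\<bar> \<le> (real N + 1) / (2 * x)" if x: "x > 0" for x
  proof -
    define k where "k = nat \<lfloor>x\<rfloor>"
    have k: "real k \<le> x" "x < real k + 1" using x by (auto simp: k_def)
    have "\<bar>real_of_int n\<bar> \<le> x \<longleftrightarrow> - int k \<le> n \<and> n < - int k + int (2*k+1)" for n
    proof -
      have "\<bar>real_of_int n\<bar> \<le> x \<longleftrightarrow> \<bar>n\<bar> \<le> \<lfloor>x\<rfloor>" by (metis le_floor_iff of_int_abs)
      also have "\<dots> \<longleftrightarrow> \<bar>n\<bar> \<le> int k" using x by (simp add: k_def)
      finally show ?thesis by auto
    qed
    then have "{n::int. \<bar>real_of_int n\<bar> \<le> x \<and> P n} = {n. - int k \<le> n \<and> n < - int k + int (2*k+1) \<and> P n}" by auto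
    then have "\<bar>real (card {n::int. \<bar>real_of_int n\<bar> \<le> x \<and> P n}) - real (2*k+1) * ?A\<bar> \<le> real N"
      using card_window[OF assms, of "- int k" "2*k+1"] by simp
    moreover have "\<bar>real (2*k+1) * ?A - 2 * x * ?A\<bar> \<le> 1"
    proof -
      have "\<bar>real (2*k+1) * ?A - 2 * x * ?A\<bar> = \<bar>real (2*k+1) - 2*x\<bar> * ?A"
        using a01 by (simp add: abs_mult flip: left_diff_distrib)
      also have "\<dots> \<le> 1 * 1" using a01 k by (intro mult_mono) auto
      finally show ?thesis by simp
    qed
    ultimately have "\<bar>real (card {n::int. \<bar>real_of_int n\<bar> \<le> x \<and> P n}) - 2 * x * ?A\<bar> \<le> real N + 1" by linarith
    then have "\<bar>real (card {n::int. \<bar>real_of_int n\<bar> \<le> x \<and> P n}) - 2 * x * ?A\<bar> / (2*x) \<le> (real N + 1) / (2*x)"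
      using x by (intro divide_right_mono) auto
    moreover have "\<bar>real (card {n::int. \<bar>real_of_int n\<bar> \<le> x \<and> P n}) - 2 * x * ?A\<bar> / (2*x) = \<bar>?f x - ?A\<bar>"
    proof -
      have "?f x - ?A = (real (card {n::int. \<bar>real_of_int n\<bar> \<le> x \<and> P n}) - 2 * x * ?A) / (2*x)"
        using x by (simp add: field_simps)
      then show ?thesis using x by (simp add: abs_divide)
    qed
    ultimately show ?thesis by simp
  qed
  have "((\<lambda>x::real. (real N + 1) / (2 * x)) \<longlongrightarrow> 0) at_top"
    by (intro tendsto_divide_0[OF tendsto_const] filterlim_at_top_imp_at_infinity
      filterlim_tendsto_pos_mult_at_top[OF tendsto_const _ filterlim_ident]) auto
  then have "((\<lambda>x. ?f x - ?A) \<longlongrightarrow> 0) at_top"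
    by (rule tendsto_0_le[where K=1]) (use bound in \<open>auto simp del: of_nat_add intro!: eventually_mono[OF eventually_gt_at_top[of 0]] order_trans[OF _ abs_ge_self]\<close>)
  then show "(?f \<longlongrightarrow> ?A) at_top" by (simp add: LIM_zero_iff)
qed simp

section \<open>Smooth numbers and distinct classes\<close>

definition smooth_on :: "nat set \<Rightarrow> nat \<Rightarrow> bool" where
  "smooth_on S m \<longleftrightarrow> m > 0 \<and> prime_factors m \<subseteq> S"

text \<open>For a finite set of primes this is the sum of \<open>1 / k\<close> over all
  \<open>S\<close>-smooth \<open>k\<close>, by the Euler product.\<close>

definition euler_prod :: "nat set \<Rightarrow> real" where
  "euler_prod S = (\<Prod>p\<in>S. 1 / (1 - 1 / real p))"

lemma euler_prod_nonneg: "(\<And>p. p \<in> S \<Longrightarrow> prime p) \<Longrightarrow> 0 \<le> euler_prod S"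
  unfolding euler_prod_def
proof (rule prod_nonneg)
  fix p assume "\<And>p. p \<in> S \<Longrightarrow> prime p" "p \<in> S"
  then have "p > 1" using prime_gt_1_nat by blast
  then show "0 \<le> 1 / (1 - 1 / real p)" by simp
qed

section \<open>Splitting off the powers of one prime\<close>

definition prime_free :: "nat \<Rightarrow> nat \<Rightarrow> nat" where
  "prime_free q k = k div q ^ multiplicity q k"

lemma prime_free_decomp: "k = q ^ multiplicity q k * prime_free q k" for k q :: nat
  by (simp add: prime_free_def multiplicity_dvd)

lemma prime_free_coprime:
  assumes "prime q" "k > 0"
  shows "coprime q (prime_free q k)" "prime_free q k > 0"
proof -
  show "prime_free q k > 0" using prime_free_decomp[of k q] assms(2) by (metis gr0I mult_0_right less_irrefl)
  have "\<not> q dvd prime_free q k"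
    using multiplicity_decompose[of k q] assms unfolding prime_free_def by (simp add: prime_nat_iff)
  then show "coprime q (prime_free q k)" using assms(1) prime_imp_coprime by blast
qed

lemma smooth_on_prime_free:
  assumes "prime q" "smooth_on (insert q S) k"
  shows "smooth_on S (prime_free q k)"
proof -
  have k: "k > 0" "prime_factors k \<subseteq> insert q S" using assms(2) by (auto simp: smooth_on_def)
  note c = prime_free_coprime[OF assms(1) k(1)]
  have "p \<in> S" if "p \<in> prime_factors (prime_free q k)" for p
  proof -
    have p: "prime p" "p dvd prime_free q k" using that by auto
    then have "p \<noteq> q" using c(1) by (metis coprime_absorb_left not_prime_unit)
    moreover have "p dvd k" using p(2) prime_free_decomp[of k q] by (metis dvd_mult)
    ultimately show ?thesis using k p(1) by (auto simp: in_prime_factors_iff)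
  qed
  then show ?thesis using c by (auto simp: smooth_on_def)
qed

lemma geometric_sum_finite_le:
  fixes x :: real
  assumes "finite I" "\<And>i. i \<in> I \<Longrightarrow> i \<ge> v" "0 \<le> x" "x < 1"
  shows "(\<Sum>i\<in>I. x ^ i) \<le> x ^ v * (1 / (1 - x))"
proof -
  have "(\<Sum>i\<in>I. x ^ i) = x ^ v * (\<Sum>i\<in>I. x ^ (i - v))"
    by (simp add: sum_distrib_left power_add[symmetric] assms(2) cong: sum.cong)
  also have "(\<Sum>i\<in>I. x ^ (i - v)) = (\<Sum>i\<in>(\<lambda>i. i - v) ` I. x ^ i)"
    by (subst sum.reindex) (use assms(2) in \<open>auto simp: inj_on_def intro: diff_is_0_eq' dest!: eq_diff_iff[THEN iffD1, rotated 2]\<close>)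
  also have "\<dots> \<le> (\<Sum>i. x ^ i)"
    using assms by (intro sum_le_suminf summable_geometric) auto
  also have "\<dots> = 1 / (1 - x)" using assms by (intro suminf_geometric) auto
  finally show ?thesis using assms(3) by (simp add: mult_left_mono)
qed

text \<open>Inside a fibre of \<open>prime_free q\<close> the exponent of \<open>q\<close>
  determines \<open>k\<close>, so distinct powers \<open>x ^ i\<close> with \<open>i \<ge> v\<close>
  are added. The start \<open>v\<close> matters: 0 yields a full Euler factor, 1 leaves out the
  trivial power, and the least exponent of a fibre is what \<open>distinct_classes_sum_le\<close>
  needs.\<close>

lemma sum_prime_power_fibre_le:
  fixes x :: real
  assumes "finite D" "prime q" "\<And>k. k \<in> D \<Longrightarrow> multiplicity q k \<ge> v" "0 \<le> x" "x < 1"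
  shows "(\<Sum>k | k \<in> D \<and> prime_free q k = j. x ^ multiplicity q k) \<le> x ^ v * (1 / (1 - x))"
proof -
  let ?F = "{k. k \<in> D \<and> prime_free q k = j}"
  have inj: "inj_on (multiplicity q) ?F"
    by (rule inj_onI) (metis (mono_tags, lifting) mem_Collect_eq prime_free_decomp)
  have "(\<Sum>k\<in>?F. x ^ multiplicity q k) = (\<Sum>i\<in>multiplicity q ` ?F. x ^ i)"
    by (simp add: sum.reindex[OF inj])
  also have "\<dots> \<le> x ^ v * (1 / (1 - x))"
    using assms by (intro geometric_sum_finite_le) auto
  finally show ?thesis .
qed

text \<open>One half of the Euler product for completely multiplicative \<open>f\<close>, one prime
  at a time. Besides \<open>1 / n\<close> it serves \<open>n powr (s - 1)\<close> in Rankin's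
  trick.\<close>

lemma smooth_sum_le:
  fixes f :: "nat \<Rightarrow> real"
  assumes "finite S" "\<And>p. p \<in> S \<Longrightarrow> prime p"
    and "\<And>n. f n \<ge> 0" "f 1 = 1" "\<And>a b. a > 0 \<Longrightarrow> b > 0 \<Longrightarrow> f (a * b) = f a * f b"
    and "\<And>p. p \<in> S \<Longrightarrow> f p < 1"
    and "finite D" "\<And>k. k \<in> D \<Longrightarrow> smooth_on S k"
  shows "(\<Sum>k\<in>D. f k) \<le> (\<Prod>p\<in>S. 1 / (1 - f p))"
  using assms
proof (induction S arbitrary: D rule: finite_induct)
  case empty
  have "D \<subseteq> {1}"
  proof
    fix k assume "k \<in> D"
    then have "smooth_on {} k" using empty by blast
    then show "k \<in> {1}" by (auto simp: smooth_on_def prime_factorization_empty_iff)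
  qed
  then have "(\<Sum>k\<in>D. f k) \<le> (\<Sum>k\<in>{1}. f k)" using empty by (intro sum_mono2) auto
  then show ?case using empty by simp
next
  case (insert q S)
  note q = insert.prems(1)[of q, simplified]
  let ?c = "prime_free q" and ?v = "multiplicity q"
  have fpow: "f (q ^ i * m) = f q ^ i * f m" if "m > 0" for i m
    using that
  proof (induction i)
    case (Suc i)
    have "f (q ^ Suc i * m) = f (q * (q ^ i * m))" by (simp add: mult.assoc)
    also have "\<dots> = f q * f (q ^ i * m)"
      using Suc.prems prime_gt_0_nat[OF q] by (intro insert.prems(4)) auto
    finally show ?case using Suc by simp
  qed simp
  have split: "f k = f q ^ ?v k * f (?c k)" if "k \<in> D" for k
    using fpow[of "?c k" "?v k"] prime_free_decomp[of k q] prime_free_coprime(2)[OF q, of k] insert.prems(7)[OF that]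
    by (metis smooth_on_def)
  have "(\<Sum>k\<in>D. f k) = (\<Sum>j\<in>?c ` D. \<Sum>k | k \<in> D \<and> ?c k = j. f k)"
    by (rule sum.image_gen[OF insert.prems(6)])
  also have "\<dots> = (\<Sum>j\<in>?c ` D. f j * (\<Sum>k | k \<in> D \<and> ?c k = j. f q ^ ?v k))"
    by (intro sum.cong) (auto simp: sum_distrib_left split mult.commute)
  also have "\<dots> \<le> (\<Sum>j\<in>?c ` D. f j * (1 / (1 - f q)))"
  proof (intro sum_mono mult_left_mono insert.prems(2))
    fix j show "(\<Sum>k | k \<in> D \<and> ?c k = j. f q ^ ?v k) \<le> 1 / (1 - f q)"
      using sum_prime_power_fibre_le[of D q 0 "f q" j] insert.prems q by simp
  qed
  also have "\<dots> = (\<Sum>j\<in>?c ` D. f j) * (1 / (1 - f q))"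
    by (simp add: sum_divide_distrib)
  also have "\<dots> \<le> (\<Prod>p\<in>S. 1 / (1 - f p)) * (1 / (1 - f q))"
  proof (rule mult_right_mono)
    show "(\<Sum>j\<in>?c ` D. f j) \<le> (\<Prod>p\<in>S. 1 / (1 - f p))"
      by (rule insert.IH) (use insert.prems smooth_on_prime_free[OF q] in auto)
    show "0 \<le> 1 / (1 - f q)" using insert.prems(5)[of q] by simp
  qed
  finally show ?case using insert.hyps by (simp add: mult.commute)
qed

text \<open>
  Induction on \<open>S\<close>: slice along the residues modulo the full power of the new prime \<open>q\<close> in \<open>N\<close>.
  Within a slice, classes whose moduli have the same \<open>q\<close>-free part collapse to one class, and the
  moduli that remain are distinct.
\<close>

lemma distinct_classes_sum_le:
  fixes b :: "nat \<Rightarrow> int"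
  assumes "finite S" "\<And>p. p \<in> S \<Longrightarrow> prime p"
    and "finite D" "\<And>k. k \<in> D \<Longrightarrow> smooth_on S k" "\<And>k. k \<in> D \<Longrightarrow> k dvd N" "N > 0"
  shows "(\<Sum>k\<in>D. 1 / real k) \<le> euler_prod S * avg N (\<lambda>x. of_bool (\<exists>k\<in>D. [x = b k] (mod int k)))"
  using assms
proof (induction S arbitrary: D N b rule: finite_induct)
  case empty
  have D: "k = 1" if "k \<in> D" for k
    using empty.prems(3)[OF that] by (auto simp: smooth_on_def prime_factorization_empty_iff)
  show ?case
  proof (cases "D = {}")
    case True then show ?thesis by (simp add: euler_prod_def avg_def)
  next
    case False
    then have "D = {1}" using D by blast
    then show ?thesis using avg_const[OF empty.prems(5), of 1] by (simp add: euler_prod_def)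
  qed
next
  case (insert q S)
  note q = insert.prems(1)[of q, simplified]
  let ?c = "prime_free q" and ?v = "multiplicity q"
  define e where "e = multiplicity q N"
  define N' where "N' = prime_free q N"
  have N: "N = q ^ e * N'" unfolding e_def N'_def by (rule prime_free_decomp)
  have copN: "coprime q N'" "N' > 0" unfolding N'_def using prime_free_coprime[OF q insert.prems(5)] .
  have kD: "k > 0" "k = q ^ ?v k * ?c k" "coprime q (?c k)" "?c k > 0" "?c k dvd N'" "?v k \<le> e" if "k \<in> D" for k
  proof -
    show k0: "k > 0" using insert.prems(3)[OF that] by (simp add: smooth_on_def)
    show kk: "k = q ^ ?v k * ?c k" by (rule prime_free_decomp)
    show c: "coprime q (?c k)" "?c k > 0" using prime_free_coprime[OF q k0] .
    have "?c k dvd N" using insert.prems(4)[OF that] kk by (metis dvd_mult_right)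
    then show "?c k dvd N'" unfolding N
      using c(1) by (metis coprime_commute coprime_dvd_mult_right_iff coprime_power_right_iff)
    show "?v k \<le> e" unfolding e_def using insert.prems(4)[OF that] insert.prems(5)
      by (intro dvd_imp_multiplicity_le) auto
  qed
  \<comment> \<open>\<open>Dt t\<close> collects the \<open>q\<close>-free parts of the moduli whose
    class meets the slice \<open>t + q ^ e * y\<close>. Where several moduli share a
    \<open>q\<close>-free part, \<open>g\<close> keeps one of them, and \<open>b'\<close> is its
    residue in the coordinate \<open>y\<close>.\<close>
  define Dt where "Dt = (\<lambda>t::int. ?c ` {k\<in>D. [t = b k] (mod int (q ^ ?v k))})"
  define g where "g = (\<lambda>t j. SOME k. k \<in> D \<and> [t = b k] (mod int (q ^ ?v k)) \<and> ?c k = j)"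
  have g: "g t j \<in> D" "[t = b (g t j)] (mod int (q ^ ?v (g t j)))" "?c (g t j) = j" if "j \<in> Dt t" for t j
  proof -
    have "\<exists>k. k \<in> D \<and> [t = b k] (mod int (q ^ ?v k)) \<and> ?c k = j" using that by (auto simp: Dt_def)
    from someI_ex[OF this] show "g t j \<in> D" "[t = b (g t j)] (mod int (q ^ ?v (g t j)))" "?c (g t j) = j"
      unfolding g_def by auto
  qed
  define b' where "b' = (\<lambda>t j. SOME y. [t + int (q ^ e) * y = b (g t j)] (mod int j))"
  have b': "[t + int (q ^ e) * b' t j = b (g t j)] (mod int j)" if "j \<in> Dt t" for t j
  proof -
    have "coprime (int (q ^ e)) (int j)" using kD(3)[OF g(1)[OF that]] g(3)[OF that] by simp
    then obtain u where u: "[int (q ^ e) * u = 1] (mod int j)" using cong_solve_coprime_int by blast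
    have "[t + int (q ^ e) * u * (b (g t j) - t) = t + 1 * (b (g t j) - t)] (mod int j)"
      by (intro cong_add cong_mult cong_refl u)
    then have "[t + int (q ^ e) * (u * (b (g t j) - t)) = b (g t j)] (mod int j)" by (simp add: mult.assoc)
    then show ?thesis unfolding b'_def by (rule someI[where P="\<lambda>y. [t + int (q ^ e) * y = b (g t j)] (mod int j)"])
  qed
  define h where "h = (\<lambda>x. of_bool (\<exists>k\<in>D. [x = b k] (mod int k)) :: real)"
  have step: "(\<Sum>j\<in>Dt t. 1 / real j) \<le> euler_prod S * avg N' (\<lambda>y. h (t + int (q ^ e) * y))" for t
  proof -
    have "(\<Sum>j\<in>Dt t. 1 / real j) \<le> euler_prod S * avg N' (\<lambda>y. of_bool (\<exists>j\<in>Dt t. [y = b' t j] (mod int j)))"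
    proof (rule insert.IH)
      show "finite (Dt t)" using insert.prems(2) by (simp add: Dt_def)
      show "smooth_on S j" if "j \<in> Dt t" for j
        using smooth_on_prime_free[OF q insert.prems(3)[OF g(1)[OF that]]] g(3)[OF that] by simp
      show "j dvd N'" if "j \<in> Dt t" for j using kD(5)[OF g(1)[OF that]] g(3)[OF that] by simp
    qed (use insert.prems copN in auto)
    also have "\<dots> \<le> euler_prod S * avg N' (\<lambda>y. h (t + int (q ^ e) * y))"
    proof (intro mult_left_mono avg_mono)
      show "0 \<le> euler_prod S" using insert.prems(1) by (intro euler_prod_nonneg) auto
      fix y
      have "\<exists>k\<in>D. [t + int (q ^ e) * y = b k] (mod int k)" if j: "j \<in> Dt t" "[y = b' t j] (mod int j)" for j
      proof
        let ?k = "g t j"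
        show "?k \<in> D" by (rule g(1)[OF j(1)])
        have 1: "[t + int (q ^ e) * y = b ?k] (mod int j)"
          by (rule cong_trans[OF _ b'[OF j(1)]]) (intro cong_add cong_mult cong_refl j(2))
        have "int (q ^ ?v ?k) dvd int (q ^ e)"
          using kD(6)[OF g(1)[OF j(1)]] by (simp add: le_imp_power_dvd)
        then have "[t + int (q ^ e) * y = t] (mod int (q ^ ?v ?k))" by (simp add: cong_iff_dvd_diff)
        then have 2: "[t + int (q ^ e) * y = b ?k] (mod int (q ^ ?v ?k))" using g(2)[OF j(1)] by (rule cong_trans)
        have "coprime (int (q ^ ?v ?k)) (int j)" using kD(3)[OF g(1)[OF j(1)]] g(3)[OF j(1)] by simp
        then have "[t + int (q ^ e) * y = b ?k] (mod (int (q ^ ?v ?k) * int j))" by (rule coprime_cong_mult[OF 2 1])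
        then show "[t + int (q ^ e) * y = b ?k] (mod int ?k)"
          using kD(2)[OF g(1)[OF j(1)]] g(3)[OF j(1)] by (metis of_nat_mult)
      qed
      then show "of_bool (\<exists>j\<in>Dt t. [y = b' t j] (mod int j)) \<le> h (t + int (q ^ e) * y)"
        unfolding h_def by auto
    qed
    finally show ?thesis .
  qed
  have cD: "finite (?c ` D)" using insert.prems(2) by simp
  \<comment> \<open>In the fibre over \<open>j\<close>, the modulus with the least power
    \<open>q ^ v0 j\<close> alone puts \<open>j\<close> into \<open>Dt t\<close> for a proportion
    \<open>q ^ (- v0 j)\<close> of the slices, while the reciprocals of the whole fibre add up to at
    most \<open>1 / j\<close> times this proportion times \<open>1 / (1 - 1 / q)\<close>. The
    quotient is exactly the new Euler factor.\<close>
  define v0 where "v0 = (\<lambda>j. Min (?v ` {k\<in>D. ?c k = j}))"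
  have "avg (q ^ e) (\<lambda>t. \<Sum>j\<in>Dt t. 1 / real j) = avg (q ^ e) (\<lambda>t. \<Sum>j\<in>?c ` D. 1 / real j * of_bool (j \<in> Dt t))"
  proof -
    have "(\<Sum>j\<in>Dt t. 1 / real j) = (\<Sum>j\<in>?c ` D. 1 / real j * of_bool (j \<in> Dt t))" for t
      using cD by (intro sum.mono_neutral_cong_left) (auto simp: Dt_def)
    then show ?thesis by simp
  qed
  also have "\<dots> = (\<Sum>j\<in>?c ` D. 1 / real j * avg (q ^ e) (\<lambda>t. of_bool (j \<in> Dt t)))"
    unfolding avg_sum avg_cmult ..
  also have "\<dots> \<ge> (\<Sum>j\<in>?c ` D. 1 / real j * (1 / real q) ^ v0 j)"
  proof (intro sum_mono mult_left_mono)
    fix j assume j: "j \<in> ?c ` D"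
    then have "v0 j \<in> ?v ` {k\<in>D. ?c k = j}" unfolding v0_def using insert.prems(2) by (intro Min_in) auto
    then obtain k where k: "k \<in> D" "?c k = j" "v0 j = ?v k" by auto
    have "(1 / real q) ^ v0 j = avg (q ^ e) (\<lambda>t. of_bool ([t = b k] (mod int (q ^ ?v k))))"
      using kD(6)[OF k(1)] prime_gt_0_nat[OF q] k(3)
      by (subst avg_class) (auto simp: le_imp_power_dvd power_one_over)
    also have "\<dots> \<le> avg (q ^ e) (\<lambda>t. of_bool (j \<in> Dt t))"
      by (intro avg_mono) (use k in \<open>auto simp: Dt_def\<close>)
    finally show "(1 / real q) ^ v0 j \<le> avg (q ^ e) (\<lambda>t. of_bool (j \<in> Dt t))" .
  qed simp
  finally have lower: "(\<Sum>j\<in>?c ` D. 1 / real j * (1 / real q) ^ v0 j) \<le> avg (q ^ e) (\<lambda>t. \<Sum>j\<in>Dt t. 1 / real j)" .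
  have q1: "1 / real q < 1" using prime_gt_1_nat[OF q] by simp
  have "(\<Sum>k\<in>D. 1 / real k) = (\<Sum>j\<in>?c ` D. \<Sum>k | k \<in> D \<and> ?c k = j. 1 / real k)"
    by (rule sum.image_gen[OF insert.prems(2)])
  also have "\<dots> = (\<Sum>j\<in>?c ` D. 1 / real j * (\<Sum>k | k \<in> D \<and> ?c k = j. (1 / real q) ^ ?v k))"
  proof (intro sum.cong refl)
    fix j
    have "1 / real k = 1 / real (?c k) * (1 / real q) ^ ?v k" if "k \<in> D" for k
    proof -
      have "real k = real q ^ ?v k * real (?c k)" using kD(2)[OF that] by (metis of_nat_mult of_nat_power)
      then show ?thesis by (simp add: power_one_over mult.commute)
    qed
    then show "(\<Sum>k | k \<in> D \<and> ?c k = j. 1 / real k) = 1 / real j * (\<Sum>k | k \<in> D \<and> ?c k = j. (1 / real q) ^ ?v k)"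
      unfolding sum_distrib_left by (intro sum.cong) auto
  qed
  also have "\<dots> \<le> (\<Sum>j\<in>?c ` D. 1 / real j * ((1 / real q) ^ v0 j * (1 / (1 - 1 / real q))))"
  proof (intro sum_mono mult_left_mono)
    fix j
    have "(\<Sum>k | k \<in> {k\<in>D. ?c k = j} \<and> ?c k = j. (1 / real q) ^ ?v k) \<le> (1 / real q) ^ v0 j * (1 / (1 - 1 / real q))"
      by (rule sum_prime_power_fibre_le) (use insert.prems(2) q q1 in \<open>auto simp: v0_def\<close>)
    moreover have "{k. k \<in> {k\<in>D. ?c k = j} \<and> ?c k = j} = {k. k \<in> D \<and> ?c k = j}" by blast
    ultimately show "(\<Sum>k | k \<in> D \<and> ?c k = j. (1 / real q) ^ ?v k) \<le> (1 / real q) ^ v0 j * (1 / (1 - 1 / real q))"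
      by simp
  qed simp
  also have "\<dots> = (\<Sum>j\<in>?c ` D. 1 / real j * (1 / real q) ^ v0 j) * (1 / (1 - 1 / real q))"
    by (simp only: sum_distrib_right mult.assoc)
  also have "\<dots> \<le> avg (q ^ e) (\<lambda>t. \<Sum>j\<in>Dt t. 1 / real j) * (1 / (1 - 1 / real q))"
    using lower q1 by (intro mult_right_mono) auto
  also have "\<dots> \<le> avg (q ^ e) (\<lambda>t. euler_prod S * avg N' (\<lambda>y. h (t + int (q ^ e) * y))) * (1 / (1 - 1 / real q))"
    using step q1 by (intro mult_right_mono avg_mono) auto
  also have "\<dots> = euler_prod (insert q S) * avg N h"
    unfolding N avg_mult avg_cmult euler_prod_def using insert.hyps by simp
  finally show ?case unfolding h_def .
qed

lemma euler_prod_smooth_sum: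
  assumes "finite S" "\<And>p. p \<in> S \<Longrightarrow> prime p" "finite D" "\<And>k. k \<in> D \<Longrightarrow> smooth_on S k"
  shows "(\<Sum>k\<in>D. 1 / real k) \<le> euler_prod S"
  unfolding euler_prod_def
proof (rule smooth_sum_le)
  show "1 / real p < 1" if "p \<in> S" for p using prime_gt_1_nat[OF assms(2)[OF that]] by simp
qed (use assms in auto)

section \<open>Estimates for primes\<close>

definition primes_upto :: "nat \<Rightarrow> nat set" where
  "primes_upto n = {p. prime p \<and> p \<le> n}"

lemma finite_primes_upto [simp]: "finite (primes_upto n)"
  unfolding primes_upto_def by (rule finite_subset[of _ "{..n}"]) auto

lemma primes_upto_4: "primes_upto 4 = {2, 3}"
proof -
  have "p = 2 \<or> p = 3" if "prime p" "p \<le> 4" for p :: nat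
  proof -
    have "p \<in> {0,1,2,3,4}" using that(2) by auto
    moreover have "\<not> prime (4::nat)" using prime_product[of 2 2] by auto
    ultimately show ?thesis using that by auto
  qed
  then show ?thesis by (auto simp: primes_upto_def)
qed

lemma prod_primes_dvd:
  fixes n :: nat
  assumes "finite P" "\<And>p. p \<in> P \<Longrightarrow> prime p" "\<And>p. p \<in> P \<Longrightarrow> p dvd n"
  shows "\<Prod>P dvd n"
  using assms
proof (induction P rule: finite_induct)
  case (insert p P)
  have "coprime p (\<Prod>P)"
    by (rule prod_coprime_right) (use insert in \<open>auto intro: primes_coprime\<close>)
  then show ?case using insert by (simp add: divides_mult)
qed simp

text \<open>Chebyshev's argument: with \<open>n = 2 ^ k\<close>, all primes above \<open>n\<close>
  and up to \<open>2 * n\<close> divide \<open>2 * n choose n \<le> 4 ^ n\<close>, and their product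
  is at least \<open>n\<close> to the power of their number.\<close>

lemma card_primes_dyadic_le:
  assumes "k \<ge> 1"
  shows "real (card {p::nat. prime p \<and> 2 ^ k < p \<and> p \<le> 2 ^ (k + 1)}) \<le> 2 ^ (k + 1) / real k"
proof -
  define n :: nat where "n = 2 ^ k"
  define P where "P = {p::nat. prime p \<and> n < p \<and> p \<le> 2 * n}"
  have P: "{p. prime p \<and> 2 ^ k < p \<and> p \<le> 2 ^ (k + 1)} = P" by (simp add: P_def n_def)
  have fin: "finite P" unfolding P_def by (rule finite_subset[of _ "{..2*n}"]) auto
  have "\<Prod>P dvd (2 * n choose n)"
  proof (rule prod_primes_dvd[OF fin])
    fix p assume p: "p \<in> P"
    then have "p dvd fact (2 * n)" by (simp add: P_def prime_dvd_fact_iff)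
    then have "p dvd fact n * fact n * (2 * n choose n)"
      using binomial_fact_lemma[of n "2*n"] by (simp add: mult_2)
    moreover have "\<not> p dvd fact n" using p by (simp add: P_def prime_dvd_fact_iff)
    ultimately show "p dvd (2 * n choose n)" using p by (simp add: P_def prime_dvd_mult_iff)
  qed (simp add: P_def)
  then have "\<Prod>P \<le> (2 * n choose n)" by (rule dvd_imp_le) (simp add: zero_less_binomial_iff)
  also have "\<dots> \<le> 2 ^ (2 * n)" by (rule binomial_le_pow2)
  finally have "\<Prod>P \<le> 2 ^ (2 * n)" .
  moreover have "n ^ card P \<le> \<Prod>P"
    using prod_mono[of P "\<lambda>_. n" "\<lambda>p. p"] by (auto simp: P_def)
  ultimately have "(2::nat) ^ (k * card P) \<le> 2 ^ (2 * n)" by (simp add: n_def power_mult)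
  then have "k * card P \<le> 2 * n" by (simp only: power_increasing_iff)
  then have "real k * real (card P) \<le> 2 ^ (k + 1)"
    unfolding n_def by (metis of_nat_le_iff of_nat_mult of_nat_numeral of_nat_power power_add power_one_right mult.commute)
  then show ?thesis unfolding P using assms by (simp add: field_simps)
qed

lemma primes_upto_pow_Suc:
  "primes_upto (2 ^ (k + 1)) = primes_upto (2 ^ k) \<union> {p. prime p \<and> 2 ^ k < p \<and> p \<le> 2 ^ (k + 1)}"
  by (auto simp: primes_upto_def)

text \<open>The dyadic block above \<open>2 ^ k\<close> has at most \<open>2 ^ (k + 1) / k\<close>
  primes, each above \<open>2 ^ k\<close>, and contributes at most \<open>2 / k\<close>; the
  harmonic sum gives the logarithm. The \<open>1 / 3\<close> is the prime 3, the only odd prime up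
  to \<open>2 ^ 2\<close>.\<close>

lemma sum_odd_prime_reciprocals_le:
  assumes "K \<ge> 2"
  shows "(\<Sum>p\<in>primes_upto (2 ^ K) - {2}. 1 / real p) \<le> 1 / 3 + 2 * ln (real K)"
proof -
  \<comment> \<open>With \<open>K - 1\<close> under the logarithm the induction closes, since
    \<open>1 / K \<le> ln K - ln (K - 1)\<close>, and the base case is an equality.\<close>
  have "(\<Sum>p\<in>primes_upto (2 ^ K) - {2}. 1 / real p) \<le> 1 / 3 + 2 * ln (real (K - 1))"
    using assms
  proof (induction K rule: dec_induct)
    case base
    have "primes_upto (2 ^ 2) - {2} = {3}" using primes_upto_4 by auto
    then show ?case by simp
  next
    case (step K)
    define B where "B = {p. prime p \<and> 2 ^ K < p \<and> p \<le> (2::nat) ^ (K + 1)}"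
    have fin: "finite B" unfolding B_def by (rule finite_subset[of _ "{..2^(K+1)}"]) auto
    have eq: "primes_upto (2 ^ Suc K) - {2} = (primes_upto (2 ^ K) - {2}) \<union> B"
    proof -
      have "2 \<notin> B" using step.hyps power_increasing[of 1 K "2::nat"] by (auto simp: B_def)
      then show ?thesis using primes_upto_pow_Suc[of K] by (auto simp: B_def)
    qed
    have disj: "(primes_upto (2 ^ K) - {2}) \<inter> B = {}" by (auto simp: primes_upto_def B_def)
    have "(\<Sum>p\<in>B. 1 / real p) \<le> (\<Sum>p\<in>B. 1 / 2 ^ K)"
    proof (rule sum_mono)
      fix p assume "p \<in> B"
      then have "real (2 ^ K) \<le> real p" unfolding B_def by (intro of_nat_mono) auto
      then show "1 / real p \<le> 1 / 2 ^ K" by (intro frac_le) auto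
    qed
    also have "\<dots> = real (card B) / 2 ^ K" by simp
    also have "\<dots> \<le> (2 ^ (K + 1) / real K) / 2 ^ K"
      using card_primes_dyadic_le[of K] step.hyps by (intro divide_right_mono) (auto simp: B_def)
    also have "\<dots> = 2 / real K" by simp
    also have "\<dots> \<le> 2 * (ln (real K) - ln (real (K - 1)))"
    proof -
      have "ln (real (K - 1) / real K) \<le> real (K - 1) / real K - 1"
        by (rule ln_le_minus_one) (use step.hyps in auto)
      moreover have "ln (real (K - 1) / real K) = ln (real (K - 1)) - ln (real K)"
        using step.hyps by (subst ln_div) auto
      moreover have "real (K - 1) / real K - 1 = - (1 / real K)"
        using step.hyps by (simp add: field_simps of_nat_diff)
      ultimately show ?thesis by simp
    qed
    finally have "(\<Sum>p\<in>B. 1 / real p) \<le> 2 * (ln (real K) - ln (real (K - 1)))" .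
    then show ?case unfolding eq sum.union_disjoint[OF finite_Diff[OF finite_primes_upto] fin disj]
      using step.IH by simp
  qed
  also have "\<dots> \<le> 1 / 3 + 2 * ln (real K)" using assms by simp
  finally show ?thesis .
qed

text \<open>A bound of Mertens type: factors \<open>1 + O(1 / p)\<close> over the primes up to
  \<open>2 ^ K\<close> multiply to at most a power of \<open>K\<close>. The prime 2 stays apart
  because the estimates of the factors are poor there, and the one in Rankin's trick,
  \<open>1 / (1 - 2 / p)\<close>, breaks down.\<close>

lemma prod_primes_upto_le:
  assumes "K \<ge> 2" "c \<ge> 0" "\<And>p. prime p \<Longrightarrow> p \<le> 2 ^ K \<Longrightarrow> 0 \<le> g p"
    "\<And>p. prime p \<Longrightarrow> p \<le> 2 ^ K \<Longrightarrow> p \<ge> 3 \<Longrightarrow> g p \<le> exp (c / real p)"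
  shows "(\<Prod>p\<in>primes_upto (2 ^ K). g p) \<le> g 2 * exp (c / 3) * real K powr (2 * c)"
proof -
  let ?P = "primes_upto (2 ^ K)"
  have two: "2 \<in> ?P" using assms(1) power_increasing[of 1 K "2::nat"] by (auto simp: primes_upto_def)
  have "(\<Prod>p\<in>?P. g p) = g 2 * (\<Prod>p\<in>?P - {2}. g p)" by (rule prod.remove[OF finite_primes_upto two])
  also have "(\<Prod>p\<in>?P - {2}. g p) \<le> (\<Prod>p\<in>?P - {2}. exp (c / real p))"
  proof (rule prod_mono, safe)
    fix p assume p: "p \<in> ?P" "p \<noteq> 2"
    then have "p \<ge> 3" using prime_ge_2_nat[of p] by (auto simp: primes_upto_def)
    then show "0 \<le> g p" "g p \<le> exp (c / real p)" using p assms(3,4) by (auto simp: primes_upto_def)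
  qed
  also have "\<dots> = exp (c * (\<Sum>p\<in>?P - {2}. 1 / real p))"
    by (simp add: exp_sum sum_distrib_left)
  also have "\<dots> \<le> exp (c * (1 / 3 + 2 * ln (real K)))"
    using sum_odd_prime_reciprocals_le[OF assms(1)] assms(2) by (simp add: mult_left_mono)
  also have "\<dots> = exp (c / 3) * real K powr (2 * c)"
    using assms(1) by (simp add: powr_def exp_add[symmetric] algebra_simps)
  finally show ?thesis using assms(3)[of 2] two by (simp add: primes_upto_def mult_left_mono mult.assoc)
qed

lemma euler_prod_primes_upto_le:
  assumes "K \<ge> 2"
  shows "euler_prod (primes_upto (2 ^ K)) \<le> 4 * real K ^ 3"
proof -
  have "euler_prod (primes_upto (2 ^ K)) \<le> (1 / (1 - 1 / real 2)) * exp ((3/2) / 3) * real K powr (2 * (3/2))"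
    unfolding euler_prod_def
  proof (rule prod_primes_upto_le[OF assms])
    fix p :: nat assume p: "prime p"
    show "0 \<le> 1 / (1 - 1 / real p)" using prime_gt_1_nat[OF p] by simp
    assume "p \<ge> 3"
    then have p3: "real p \<ge> 3" by simp
    have "1 / (1 - 1 / real p) = 1 + 1 / (real p - 1)" using p3 by (simp add: field_simps)
    also have "\<dots> \<le> exp (1 / (real p - 1))" by (rule exp_ge_add_one_self)
    \<comment> \<open>For \<open>p \<ge> 3\<close> one has \<open>p - 1 \<ge> 2 / 3 * p\<close>; the
      constant \<open>c = 3 / 2\<close> becomes the exponent \<open>2 * c = 3\<close> of
      \<open>K\<close>.\<close>
    also have "\<dots> \<le> exp (3 / 2 / real p)" using p3 by (simp add: field_simps)
    finally show "1 / (1 - 1 / real p) \<le> exp (3 / 2 / real p)" .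
  qed simp
  also have "exp ((3/2) / 3 :: real) \<le> 2"
  proof -
    have "exp (1/2 :: real) ^ 2 = exp 1" by (simp add: power2_eq_square flip: exp_add)
    also have "\<dots> \<le> 2 ^ 2" using exp_le by simp
    finally have "exp (1/2 :: real) \<le> 2" by (rule power2_le_imp_le) simp
    then show ?thesis by simp
  qed
  finally show ?thesis using assms by (simp add: mult_right_mono)
qed

text \<open>
  This is where the primes 2 and 3 are special: \<open>euler_prod (primes_upto (p - 1)) / (p - 1)\<close>, the
  largest fraction that moduli with largest prime factor \<open>p\<close> can cover, is below 1 only for \<open>p \<ge> 5\<close>.
\<close>

lemma euler_prod_primes_upto_linear:
  assumes "n \<ge> 4"
  shows "euler_prod (primes_upto n) \<le> 3 / 4 * real n"
  using assms
proof (induction n rule: dec_induct)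
  case base
  show ?case by (simp add: primes_upto_4 euler_prod_def)
next
  case (step n)
  show ?case
  proof (cases "prime (Suc n)")
    case True
    then have "primes_upto (Suc n) = insert (Suc n) (primes_upto n)" by (auto simp: primes_upto_def le_Suc_eq)
    moreover have "Suc n \<notin> primes_upto n" by (simp add: primes_upto_def)
    ultimately have "euler_prod (primes_upto (Suc n)) = 1 / (1 - 1 / real (Suc n)) * euler_prod (primes_upto n)"
      by (simp add: euler_prod_def)
    also have "1 / (1 - 1 / real (Suc n)) = real (Suc n) / real n" using step.hyps by (simp add: field_simps)
    also have "real (Suc n) / real n * euler_prod (primes_upto n) \<le> real (Suc n) / real n * (3 / 4 * real n)"
      using step.IH by (intro mult_left_mono) auto
    also have "\<dots> = 3 / 4 * real (Suc n)" using step.hyps by simp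
    finally show ?thesis .
  next
    case False
    then have "primes_upto (Suc n) = primes_upto n" by (auto simp: primes_upto_def le_Suc_eq)
    then show ?thesis using step.IH by simp
  qed
qed

section \<open>Sieving by pairwise disjoint classes\<close>

text \<open>Starting from the multiset of prime factors makes infinite \<open>S\<close>, in
  particular complements, admissible; 0 is sent to 1, so the value is always positive.\<close>

definition part_on :: "nat set \<Rightarrow> nat \<Rightarrow> nat" where
  "part_on S m = prod_mset {#p \<in># prime_factorization m. p \<in> S#}"

lemma prime_factorization_part_on:
  "prime_factorization (part_on S m) = {#p \<in># prime_factorization m. p \<in> S#}"
  unfolding part_on_def by (rule prime_factorization_prod_mset_primes) auto

lemma part_on_pos [simp]: "part_on S m > 0"
proof -
  have "0 \<notin># {#p \<in># prime_factorization m. p \<in> S#}" by (auto dest: in_prime_factors_imp_prime)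
  then show ?thesis unfolding part_on_def by (metis gr0I prod_mset_zero_iff)
qed

lemma smooth_on_part_on: "smooth_on S (part_on S m)"
  by (auto simp: smooth_on_def prime_factorization_part_on)

lemma part_on_decomp: "m > 0 \<Longrightarrow> part_on S m * part_on (- S) m = m"
proof -
  assume "m > 0"
  have "part_on S m * part_on (- S) m = prod_mset (prime_factorization m)"
    unfolding part_on_def prod_mset.union[symmetric] by (simp add: multiset_partition[symmetric])
  then show ?thesis using \<open>m > 0\<close> by (simp add: prod_mset_prime_factorization_nat)
qed

lemma smooth_on_part_on_compl:
  assumes "smooth_on S m"
  shows "smooth_on (S - Z) (part_on (- Z) m)"
  using assms by (auto simp: smooth_on_def prime_factorization_part_on)

lemma smooth_on_mono: "smooth_on S m \<Longrightarrow> S \<subseteq> T \<Longrightarrow> smooth_on T m"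
  by (auto simp: smooth_on_def)

lemma smooth_on_mult: "smooth_on S m \<Longrightarrow> smooth_on S n \<Longrightarrow> smooth_on S (m * n)"
  by (auto simp: smooth_on_def prime_factors_product)

lemma coprime_smooth_on:
  assumes "smooth_on A m" "smooth_on B n" "A \<inter> B = {}"
  shows "coprime m n"
proof (rule ccontr)
  assume "\<not> coprime m n"
  then have "gcd m n \<noteq> 1" using coprime_iff_gcd_eq_1 by blast
  then obtain p where p: "prime p" "p dvd gcd m n" using prime_factor_nat by blast
  then have "p dvd m" "p dvd n" by auto
  then have "p \<in> prime_factors m" "p \<in> prime_factors n"
    using p(1) assms by (simp_all add: smooth_on_def in_prime_factors_iff)
  then show False using assms by (auto simp only: smooth_on_def)
qed

text \<open>A distinct system is encoded by the set \<open>M\<close> of its moduli and a function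
  \<open>a\<close> that gives the residue belonging to each modulus.\<close>

definition uncovered :: "nat set \<Rightarrow> (nat \<Rightarrow> int) \<Rightarrow> int \<Rightarrow> bool" where
  "uncovered M a x \<longleftrightarrow> (\<forall>m\<in>M. \<not> [x = a m] (mod int m))"

definition smooth_part :: "nat set \<Rightarrow> nat set \<Rightarrow> nat set" where
  "smooth_part S M = {m \<in> M. smooth_on S m}"

lemma periodic_uncovered:
  assumes "\<And>m. m \<in> M \<Longrightarrow> m dvd N"
  shows "periodic N (uncovered M a)"
proof -
  have "periodic N (\<lambda>x. \<exists>k\<in>M. [x = a k] (mod int k))" by (rule periodic_Ex_class) (use assms in auto)
  then have "periodic N (\<lambda>x. \<not> (\<exists>k\<in>M. [x = a k] (mod int k)))" by (rule periodic_comp)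
  then show ?thesis by (simp add: uncovered_def[abs_def])
qed

definition disjoint_classes :: "nat set \<Rightarrow> (nat \<Rightarrow> int) \<Rightarrow> bool" where
  "disjoint_classes M a \<longleftrightarrow>
     (\<forall>m\<in>M. \<forall>n\<in>M. \<forall>x. [x = a m] (mod int m) \<longrightarrow> [x = a n] (mod int n) \<longrightarrow> m = n)"

lemma avg_uncovered_diff_le:
  assumes "finite T" "\<And>m. m \<in> T \<Longrightarrow> m dvd N" "N > 0" "M \<subseteq> M' \<union> T"
  shows "avg N (\<lambda>x. of_bool (uncovered M' a x)) - (\<Sum>m\<in>T. 1 / real m) \<le> avg N (\<lambda>x. of_bool (uncovered M a x))"
proof -
  have "avg N (\<lambda>x. of_bool (uncovered M' a x) - (\<Sum>m\<in>T. of_bool ([x = a m] (mod int m))))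
    \<le> avg N (\<lambda>x. of_bool (uncovered M a x))"
  proof (rule avg_mono)
    fix x
    show "of_bool (uncovered M' a x) - (\<Sum>m\<in>T. of_bool ([x = a m] (mod int m))) \<le> (of_bool (uncovered M a x) :: real)"
    proof (cases "uncovered M' a x \<and> \<not> uncovered M a x")
      case True
      then obtain m where m: "m \<in> T" "[x = a m] (mod int m)" using assms(4) by (auto simp: uncovered_def)
      have "of_bool ([x = a m] (mod int m)) \<le> (\<Sum>m\<in>T. of_bool ([x = a m] (mod int m)) :: real)"
        by (rule member_le_sum) (use m assms(1) in auto)
      then show ?thesis using m(2) True by simp
    next
      case False
      have "(\<Sum>m\<in>T. of_bool ([x = a m] (mod int m)) :: real) \<ge> 0" by (intro sum_nonneg) auto
      then show ?thesis using False by auto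
    qed
  qed
  then have "avg N (\<lambda>x. of_bool (uncovered M' a x)) - (\<Sum>m\<in>T. avg N (\<lambda>x. of_bool ([x = a m] (mod int m))))
    \<le> avg N (\<lambda>x. of_bool (uncovered M a x))"
    unfolding avg_diff avg_sum .
  moreover have "(\<Sum>m\<in>T. avg N (\<lambda>x. of_bool ([x = a m] (mod int m)))) = (\<Sum>m\<in>T. 1 / real m)"
    using assms by (intro sum.cong avg_class) auto
  ultimately show ?thesis by simp
qed

text \<open>\<open>Z\<close> holds the old primes, \<open>S - Z\<close> the new ones. The arithmetic
  of the new primes enters only through \<open>c\<close>, a bound for families of pairwise
  non-coprime \<open>r\<close>; a single prime and a whole range of primes differ only in how
  \<open>c\<close> is found. The loss itself is a union bound, grouped by \<open>r\<close>: each
  group is \<open>1 / r\<close> times a sum of \<open>1 / k\<close> over distinct old parts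
  \<open>k\<close>.\<close>

lemma disjoint_classes_sieve:
  assumes "disjoint_classes M a" "finite M" "\<And>m. m \<in> M \<Longrightarrow> m dvd N" "N > 0"
    and "finite Z" "\<And>p. p \<in> Z \<Longrightarrow> prime p" "Z \<subseteq> S"
    and R: "\<And>R. finite R \<Longrightarrow> (\<And>r. r \<in> R \<Longrightarrow> smooth_on (S - Z) r \<and> r > 1 \<and> (\<exists>m\<in>M. r dvd m)) \<Longrightarrow>
        (\<And>r s. r \<in> R \<Longrightarrow> s \<in> R \<Longrightarrow> \<not> coprime r s) \<Longrightarrow> (\<Sum>r\<in>R. 1 / real r) \<le> c"
  shows "(1 - c * euler_prod Z) * avg N (\<lambda>x. of_bool (uncovered (smooth_part Z M) a x))
    \<le> avg N (\<lambda>x. of_bool (uncovered (smooth_part S M) a x))"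
proof -
  let ?U = "\<lambda>x. of_bool (uncovered (smooth_part Z M) a x) :: real"
  define T where "T = {m\<in>M. smooth_on S m \<and> \<not> smooth_on Z m}"
  define rough where "rough = part_on (- Z)"
  define core where "core = part_on Z"
  have T: "finite T" "\<And>m. m \<in> T \<Longrightarrow> m dvd N" using assms(2,3) by (auto simp: T_def)
  have mT: "m > 0" "core m * rough m = m" "smooth_on Z (core m)" "smooth_on (S - Z) (rough m)" "rough m > 1"
    if "m \<in> T" for m
  proof -
    show "m > 0" using T(2)[OF that] assms(4) by (auto intro: Nat.gr0I)
    then show cr: "core m * rough m = m" unfolding core_def rough_def by (rule part_on_decomp)
    show cs: "smooth_on Z (core m)" unfolding core_def by (rule smooth_on_part_on)
    show "smooth_on (S - Z) (rough m)" unfolding rough_def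
      by (rule smooth_on_part_on_compl) (use that in \<open>simp add: T_def\<close>)
    have "rough m \<noteq> 1" using cr cs that by (auto simp: T_def)
    moreover have "rough m > 0" by (simp add: rough_def)
    ultimately show "rough m > 1" by simp
  qed
  define K where "K = (\<lambda>r. core ` {m\<in>T. rough m = r})"
  \<comment> \<open>\<open>E r x\<close> places \<open>x\<close> in the class modulo some
    \<open>k\<close> that contains the class modulo \<open>k * r\<close>, a condition on
    \<open>x\<close> in terms of old primes only.\<close>
  define E where "E = (\<lambda>r x. \<exists>k\<in>K r. [x = a (k * r)] (mod int k))"
  have K: "k * r \<in> T" "smooth_on Z k" "rough (k * r) = r" "core (k * r) = k" if "k \<in> K r" for k r
    using that mT unfolding K_def by (auto simp: mult.commute)
  have finK: "finite (K r)" for r using T(1) by (simp add: K_def)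
  \<comment> \<open>As \<open>k * l\<close> and \<open>r * s\<close> are coprime, a point
    \<open>x\<close> of the two coarser classes modulo \<open>k\<close> and \<open>l\<close> can be
    moved, by two uses of the Chinese remainder theorem, to a point of both full classes.
    Disjointness then forces \<open>m = n\<close>.\<close>
  have pair: "m = n"
    if m: "m = k * r" "m \<in> M" and n: "n = l * s" "n \<in> M"
      and x: "[x = a m] (mod int k)" "[x = a n] (mod int l)"
      and sm: "smooth_on Z k" "smooth_on Z l" "smooth_on (- Z) r" "smooth_on (- Z) s" "coprime r s" for m n k l r s x
  proof -
    have c1: "coprime (int (k * l)) (int (r * s))"
      using coprime_smooth_on[OF smooth_on_mult[OF sm(1,2)] smooth_on_mult[OF sm(3,4)]]
      by (simp only: coprime_int_iff Compl_disjoint)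
    obtain y where y: "[y = a m] (mod int r)" "[y = a n] (mod int s)"
      using binary_chinese_remainder_int[of "int r" "int s"] sm(5) by auto
    obtain X where X: "[X = x] (mod int (k * l))" "[X = y] (mod int (r * s))"
      using binary_chinese_remainder_int[OF c1] by blast
    have Xk: "[X = a m] (mod int k)" "[X = a n] (mod int l)"
      using X(1) x by (meson cong_dvd_modulus cong_trans of_nat_dvd_iff dvd_triv_left dvd_triv_right)+
    have Xr: "[X = a m] (mod int r)" "[X = a n] (mod int s)"
      using X(2) y by (meson cong_dvd_modulus cong_trans of_nat_dvd_iff dvd_triv_left dvd_triv_right)+
    have "coprime (int k) (int r)" "coprime (int l) (int s)"
      using coprime_smooth_on[OF sm(1,3)] coprime_smooth_on[OF sm(2,4)] by auto
    then have "[X = a m] (mod int m)" "[X = a n] (mod int n)"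
      using coprime_cong_mult[OF Xk(1) Xr(1)] coprime_cong_mult[OF Xk(2) Xr(2)] m n by simp_all
    then show ?thesis using assms(1) m n unfolding disjoint_classes_def by blast
  qed
  have sZ: "smooth_on (- Z) r" if "smooth_on (S - Z) r" for r
    using that by (rule smooth_on_mono) auto
  have s1: "smooth_on (- Z) 1" by (simp add: smooth_on_def)
  have point: "(\<Sum>r\<in>rough ` T. 1 / real r * of_bool (E r x)) \<le> c * ?U x" for x
  proof -
    define R where "R = {r \<in> rough ` T. E r x}"
    have "(\<Sum>r\<in>rough ` T. 1 / real r * of_bool (E r x)) = (\<Sum>r\<in>R. 1 / real r)"
      unfolding R_def using T(1) by (intro sum.mono_neutral_cong_right) auto
    also have "\<dots> \<le> c * ?U x"
    proof (cases "uncovered (smooth_part Z M) a x")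
      case True
      have "(\<Sum>r\<in>R. 1 / real r) \<le> c"
      proof (rule assms(8))
        show "finite R" using T(1) by (simp add: R_def)
        fix r assume "r \<in> R"
        then obtain m where m: "m \<in> T" "r = rough m" by (auto simp: R_def)
        then show "smooth_on (S - Z) r \<and> r > 1 \<and> (\<exists>m\<in>M. r dvd m)"
          using mT[OF m(1)] by (metis (no_types, lifting) T_def dvd_triv_right mem_Collect_eq)
      next
        fix r s assume rs: "r \<in> R" "s \<in> R"
        obtain k where k: "k \<in> K r" "[x = a (k * r)] (mod int k)" using rs(1) by (auto simp: R_def E_def)
        obtain l where l: "l \<in> K s" "[x = a (l * s)] (mod int l)" using rs(2) by (auto simp: R_def E_def)
        note k' = K[OF k(1)] mT[OF K(1)[OF k(1)]] and l' = K[OF l(1)] mT[OF K(1)[OF l(1)]]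
        show "\<not> coprime r s"
        proof
          assume cop: "coprime r s"
          have "k * r = l * s"
            by (rule pair[OF refl _ refl _ k(2) l(2) k'(2) l'(2) sZ sZ cop])
              (use k' l' in \<open>auto simp: T_def\<close>)
          then have "r = s" using k'(3) l'(3) by simp
          then show False using cop k' by simp
        qed
      qed
      then show ?thesis using True by simp
    next
      case False
      then obtain n where n: "n \<in> M" "smooth_on Z n" "[x = a n] (mod int n)"
        by (auto simp: uncovered_def smooth_part_def)
      have "r \<notin> R" for r
      proof
        assume "r \<in> R"
        then obtain k where k: "k \<in> K r" "[x = a (k * r)] (mod int k)" by (auto simp: R_def E_def)
        note k' = K[OF k(1)] mT[OF K(1)[OF k(1)]]
        \<comment> \<open>A \<open>Z\<close>-smooth modulus has new part 1, which is coprime to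
          every \<open>r\<close>.\<close>
        have "k * r = n"
          by (rule pair[OF refl _ _ n(1) k(2) n(3) k'(2) n(2) sZ s1]) (use k' in \<open>auto simp: T_def\<close>)
        then show False using n(2) k'(1) by (simp add: T_def)
      qed
      then have "R = {}" by blast
      then show ?thesis using False by simp
    qed
    finally show ?thesis .
  qed
  have "(\<Sum>m\<in>T. 1 / real m) = (\<Sum>r\<in>rough ` T. \<Sum>m | m \<in> T \<and> rough m = r. 1 / real m)"
    by (rule sum.image_gen[OF T(1)])
  also have "\<dots> = (\<Sum>r\<in>rough ` T. 1 / real r * (\<Sum>k\<in>K r. 1 / real k))"
  proof (intro sum.cong refl)
    fix r
    have "inj_on core {m\<in>T. rough m = r}"
      by (rule inj_onI) (metis (mono_tags, lifting) mT(2) mem_Collect_eq)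
    then have "(\<Sum>k\<in>K r. 1 / real k) = (\<Sum>m\<in>{m\<in>T. rough m = r}. 1 / real (core m))"
      unfolding K_def by (simp add: sum.reindex)
    moreover have "1 / real m = 1 / real r * (1 / real (core m))" if "m \<in> {m\<in>T. rough m = r}" for m
      using mT(2)[of m] that by (metis (mono_tags, lifting) mem_Collect_eq mult.commute mult_1 of_nat_mult times_divide_times_eq)
    ultimately show "(\<Sum>m | m \<in> T \<and> rough m = r. 1 / real m) = 1 / real r * (\<Sum>k\<in>K r. 1 / real k)"
      by (simp add: sum_distrib_left)
  qed
  also have "\<dots> \<le> (\<Sum>r\<in>rough ` T. 1 / real r * (euler_prod Z * avg N (\<lambda>x. of_bool (E r x))))"
  proof (intro sum_mono mult_left_mono)
    fix r
    show "(\<Sum>k\<in>K r. 1 / real k) \<le> euler_prod Z * avg N (\<lambda>x. of_bool (E r x))"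
      unfolding E_def
    proof (rule distinct_classes_sum_le[OF assms(5,6) finK K(2) _ assms(4)])
      show "k dvd N" if "k \<in> K r" for k
        using T(2)[OF K(1)[OF that]] by (rule dvd_mult_left)
    qed auto
  qed simp
  also have "\<dots> = euler_prod Z * avg N (\<lambda>x. \<Sum>r\<in>rough ` T. 1 / real r * of_bool (E r x))"
    unfolding avg_sum avg_cmult by (simp add: sum_distrib_left mult.assoc mult.left_commute)
  also have "\<dots> \<le> euler_prod Z * avg N (\<lambda>x. c * ?U x)"
    by (intro mult_left_mono avg_mono point euler_prod_nonneg assms(6))
  also have "\<dots> = c * euler_prod Z * avg N ?U" unfolding avg_cmult by simp
  finally have "(\<Sum>m\<in>T. 1 / real m) \<le> c * euler_prod Z * avg N ?U" .
  moreover have "avg N ?U - (\<Sum>m\<in>T. 1 / real m) \<le> avg N (\<lambda>x. of_bool (uncovered (smooth_part S M) a x))"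
    by (rule avg_uncovered_diff_le[OF T assms(4)]) (auto simp: smooth_part_def T_def)
  ultimately show ?thesis by (simp add: algebra_simps)
qed

lemma euler_prod_mono:
  assumes "finite S" "T \<subseteq> S" "\<And>p. p \<in> S \<Longrightarrow> prime p"
  shows "euler_prod T \<le> euler_prod S"
  unfolding euler_prod_def
proof (rule prod_mono2[OF assms(1,2)])
  fix p assume "p \<in> S - T"
  then have "p > 1" using assms(3) prime_gt_1_nat by blast
  then show "1 \<le> 1 / (1 - 1 / real p)" by (simp add: field_simps)
next
  fix p assume "p \<in> T"
  then have "p > 1" using assms(2,3) prime_gt_1_nat by blast
  then show "0 \<le> 1 / (1 - 1 / real p)" by simp
qed

section \<open>Primes treated one at a time\<close>

lemma sum_prime_powers_le:
  assumes "prime p" "finite R" "\<And>r. r \<in> R \<Longrightarrow> smooth_on {p} r \<and> r > 1"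
  shows "(\<Sum>r\<in>R. 1 / real r) \<le> 1 / real (p - 1)"
proof -
  have free: "prime_free p r = 1" if "r \<in> R" for r
    using smooth_on_prime_free[OF assms(1), of "{}" r] assms(3)[OF that]
    by (auto simp: smooth_on_def prime_factorization_empty_iff)
  have decomp: "r = p ^ multiplicity p r" if "r \<in> R" for r
    using prime_free_decomp[of r p] free[OF that] by simp
  have "(\<Sum>r\<in>R. 1 / real r) = (\<Sum>r | r \<in> R \<and> prime_free p r = 1. (1 / real p) ^ multiplicity p r)"
  proof (rule sum.cong)
    fix r assume "r \<in> {r \<in> R. prime_free p r = 1}"
    then have "real r = real p ^ multiplicity p r" using decomp by (metis mem_Collect_eq of_nat_power)
    then show "1 / real r = (1 / real p) ^ multiplicity p r" by (simp add: power_one_over)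
  qed (use free in auto)
  also have "\<dots> \<le> (1 / real p) ^ 1 * (1 / (1 - 1 / real p))"
  proof (rule sum_prime_power_fibre_le[OF assms(2,1)])
    fix r assume "r \<in> R"
    then show "1 \<le> multiplicity p r" using decomp[of r] assms(3)[of r] by (metis One_nat_def Suc_leI gr0I less_irrefl power_0)
  qed (use prime_gt_1_nat[OF assms(1)] in auto)
  also have "\<dots> = 1 / real (p - 1)" using prime_gt_1_nat[OF assms(1)] by (simp add: field_simps of_nat_diff)
  finally show ?thesis .
qed

text \<open>Turns factors \<open>1 - x\<close> into exponentials, so that the losses of many primes
  add up in the exponent. The 4 is \<open>1 / (1 - 3 / 4)\<close>, with \<open>3 / 4\<close> from
  \<open>euler_prod_primes_upto_linear\<close>.\<close>

lemma exp_le_one_minus: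
  fixes x :: real
  assumes "0 \<le> x" "x \<le> 3 / 4"
  shows "exp (- 4 * x) \<le> 1 - x"
proof -
  have "1 / (1 - x) = 1 + x / (1 - x)" using assms by (simp add: field_simps)
  also have "\<dots> \<le> exp (x / (1 - x))" by (rule exp_ge_add_one_self)
  also have "\<dots> \<le> exp (4 * x)"
  proof -
    have "x / (1 - x) \<le> x / (1 / 4)" using assms by (intro divide_left_mono) auto
    then show ?thesis by simp
  qed
  finally show ?thesis using assms by (simp add: exp_minus field_simps)
qed

text \<open>The loss \<open>rho\<close> at a prime \<open>p = n + 1\<close> is estimated twice:
  \<open>rho \<le> 3 / 4\<close> keeps the factor \<open>1 - rho\<close> away from 0, and
  \<open>rho \<le> euler_prod (primes_upto z) / (p - 1)\<close>, with one Euler product for all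
  primes up to the cutoff \<open>z\<close>, controls the accumulated loss.\<close>

lemma uncovered_small_primes:
  assumes M: "disjoint_classes M a" "finite M" "\<And>m. m \<in> M \<Longrightarrow> m dvd N" "N > 0"
    and n: "4 \<le> n" "n \<le> z"
  shows "avg N (\<lambda>x. of_bool (uncovered (smooth_part (primes_upto 4) M) a x))
      * exp (- 4 * euler_prod (primes_upto z) * (\<Sum>p\<in>primes_upto n - {2,3}. 1 / real (p - 1)))
    \<le> avg N (\<lambda>x. of_bool (uncovered (smooth_part (primes_upto n) M) a x))"
  using n
proof (induction n rule: dec_induct)
  case base
  have "primes_upto 4 - {2,3} = {}" using primes_upto_4 by simp
  then show ?case by (simp only: sum.empty) (simp add: avg_nonneg)
next
  case (step n)
  define E where "E = euler_prod (primes_upto z)"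
  define A where "A = (\<lambda>n. avg N (\<lambda>x. of_bool (uncovered (smooth_part (primes_upto n) M) a x)))"
  have A0: "A n \<ge> 0" for n unfolding A_def by (rule avg_nonneg) simp
  have IH: "A 4 * exp (- 4 * E * (\<Sum>p\<in>primes_upto n - {2,3}. 1 / real (p - 1))) \<le> A n"
    using step by (simp add: A_def E_def)
  have "A 4 * exp (- 4 * E * (\<Sum>p\<in>primes_upto (Suc n) - {2,3}. 1 / real (p - 1))) \<le> A (Suc n)"
  proof (cases "prime (Suc n)")
    case True
    have ins: "primes_upto (Suc n) = insert (Suc n) (primes_upto n)" using True by (auto simp: primes_upto_def le_Suc_eq)
    have new: "Suc n \<notin> primes_upto n" by (simp add: primes_upto_def)
    define rho where "rho = 1 / real n * euler_prod (primes_upto n)"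
    have rho: "0 \<le> rho" "rho \<le> 3 / 4" "rho \<le> E * (1 / real n)"
    proof -
      show "0 \<le> rho" unfolding rho_def by (intro mult_nonneg_nonneg euler_prod_nonneg) (auto simp: primes_upto_def)
      show "rho \<le> 3 / 4" unfolding rho_def using euler_prod_primes_upto_linear[of n] step.hyps by (simp add: field_simps)
      have "euler_prod (primes_upto n) \<le> E" unfolding E_def
        by (rule euler_prod_mono) (use step.prems in \<open>auto simp: primes_upto_def\<close>)
      then show "rho \<le> E * (1 / real n)" unfolding rho_def by (simp add: divide_right_mono)
    qed
    have "(1 - 1 / real (Suc n - 1) * euler_prod (primes_upto n)) * A n \<le> A (Suc n)"
      unfolding A_def
    proof (rule disjoint_classes_sieve[OF M])
      fix R :: "nat set" assume R: "finite R" "\<And>r. r \<in> R \<Longrightarrow> smooth_on (primes_upto (Suc n) - primes_upto n) r \<and> r > 1 \<and> (\<exists>m\<in>M. r dvd m)"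
      have "primes_upto (Suc n) - primes_upto n = {Suc n}" using ins new by auto
      then show "(\<Sum>r\<in>R. 1 / real r) \<le> 1 / real (Suc n - 1)"
        using sum_prime_powers_le[OF True R(1)] R(2) by auto
    qed (auto simp: primes_upto_def)
    then have "(1 - rho) * A n \<le> A (Suc n)" by (simp add: rho_def)
    have "A 4 * exp (- 4 * E * (\<Sum>p\<in>primes_upto (Suc n) - {2,3}. 1 / real (p - 1)))
      = A 4 * exp (- 4 * E * (\<Sum>p\<in>primes_upto n - {2,3}. 1 / real (p - 1))) * exp (- 4 * (E * (1 / real n)))"
    proof -
      have "primes_upto (Suc n) - {2,3} = insert (Suc n) (primes_upto n - {2,3})" using ins step.hyps by auto
      then show ?thesis using new by (simp add: exp_add[symmetric] algebra_simps)
    qed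
    also have "\<dots> \<le> A n * exp (- 4 * rho)"
      using IH rho(3) A0 by (intro mult_mono) auto
    also have "\<dots> \<le> A n * (1 - rho)"
      using exp_le_one_minus[OF rho(1,2)] A0 by (intro mult_left_mono) auto
    finally show ?thesis using \<open>(1 - rho) * A n \<le> A (Suc n)\<close> by (simp add: mult.commute)
  next
    case False
    then have "primes_upto (Suc n) = primes_upto n" by (auto simp: primes_upto_def le_Suc_eq)
    then show ?thesis using IH by (simp add: A_def)
  qed
  then show ?case by (simp add: A_def E_def)
qed

text \<open>The 20 is \<open>4 * 4 * 5 / 4\<close>: from \<open>exp_le_one_minus\<close>, from
  \<open>euler_prod_primes_upto_le\<close>, and from \<open>p / (p - 1) \<le> 5 / 4\<close> for
  \<open>p \<ge> 5\<close>.\<close>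

lemma uncovered_primes_upto_power:
  assumes M: "disjoint_classes M a" "finite M" "\<And>m. m \<in> M \<Longrightarrow> m dvd N" "N > 0" and k: "2 \<le> k"
  shows "avg N (\<lambda>x. of_bool (uncovered (smooth_part (primes_upto 4) M) a x))
      * exp (- 20 * real k ^ 3 * (1 / 3 + 2 * ln (real k)))
    \<le> avg N (\<lambda>x. of_bool (uncovered (smooth_part (primes_upto (2 ^ k)) M) a x))"
proof -
  let ?P = "primes_upto (2 ^ k)" and ?A = "avg N (\<lambda>x. of_bool (uncovered (smooth_part (primes_upto 4) M) a x))"
  have "(\<Sum>p\<in>?P - {2,3}. 1 / real (p - 1)) \<le> (\<Sum>p\<in>?P - {2,3}. 5 / 4 * (1 / real p))"
  proof (rule sum_mono)
    fix p assume p: "p \<in> ?P - {2,3}"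
    then have "p \<noteq> 4" using prime_product[of 2 2] by (auto simp: primes_upto_def)
    then have "p \<ge> 5" using p prime_ge_2_nat[of p] by (auto simp: primes_upto_def)
    then show "1 / real (p - 1) \<le> 5 / 4 * (1 / real p)" by (simp add: field_simps of_nat_diff)
  qed
  also have "\<dots> \<le> 5 / 4 * (\<Sum>p\<in>?P - {2}. 1 / real p)"
    unfolding sum_distrib_left[symmetric] by (intro mult_left_mono sum_mono2) auto
  also have "\<dots> \<le> 5 / 4 * (1 / 3 + 2 * ln (real k))"
    using sum_odd_prime_reciprocals_le[OF k] by simp
  finally have S: "(\<Sum>p\<in>?P - {2,3}. 1 / real (p - 1)) \<le> 5 / 4 * (1 / 3 + 2 * ln (real k))" .
  have "euler_prod ?P * (\<Sum>p\<in>?P - {2,3}. 1 / real (p - 1)) \<le> (4 * real k ^ 3) * (5 / 4 * (1 / 3 + 2 * ln (real k)))"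
    by (intro mult_mono S euler_prod_primes_upto_le k euler_prod_nonneg sum_nonneg) (auto simp: primes_upto_def)
  then have "exp (- 20 * real k ^ 3 * (1 / 3 + 2 * ln (real k)))
      \<le> exp (- 4 * euler_prod ?P * (\<Sum>p\<in>?P - {2,3}. 1 / real (p - 1)))"
    by (simp add: algebra_simps)
  then have "?A * exp (- 20 * real k ^ 3 * (1 / 3 + 2 * ln (real k)))
      \<le> ?A * exp (- 4 * euler_prod ?P * (\<Sum>p\<in>?P - {2,3}. 1 / real (p - 1)))"
    by (intro mult_left_mono avg_nonneg) auto
  also have "\<dots> \<le> avg N (\<lambda>x. of_bool (uncovered (smooth_part ?P M) a x))"
    by (rule uncovered_small_primes[OF M]) (use power_increasing[OF k, of "2::nat"] in auto)
  finally show ?thesis .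
qed

text \<open>Fix one member \<open>s\<close>. Every member shares a prime with it,
  \<open>s \<le> 2 ^ J\<close> has at most \<open>J\<close> distinct primes, and the multiples of a
  prime \<open>p > z\<close> contribute at most \<open>euler_prod S / p\<close>.\<close>

lemma intersecting_family_sum_le:
  assumes S: "finite S" "\<And>p. p \<in> S \<Longrightarrow> prime p \<and> p > z" and z: "z > 0"
    and R: "finite R" "\<And>r. r \<in> R \<Longrightarrow> smooth_on S r \<and> r \<le> 2 ^ J"
    and cop: "\<And>r s. r \<in> R \<Longrightarrow> s \<in> R \<Longrightarrow> \<not> coprime r s"
  shows "(\<Sum>r\<in>R. 1 / real r) \<le> real J * euler_prod S / real z"
proof (cases "R = {}")
  case True
  then show ?thesis using S by (simp add: euler_prod_nonneg)
next
  case False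
  then obtain s where s: "s \<in> R" by blast
  have EP: "0 \<le> euler_prod S" using S by (intro euler_prod_nonneg) auto
  let ?F = "prime_factors s"
  have "2 ^ card ?F \<le> \<Prod>?F"
    using prod_mono[of ?F "\<lambda>_. 2::nat" "\<lambda>p. p"] prime_ge_2_nat by auto
  also have "\<dots> \<le> s"
    using R(2)[OF s] by (intro dvd_imp_le prod_primes_dvd) (auto simp: smooth_on_def)
  also have "\<dots> \<le> 2 ^ J" using R(2)[OF s] by blast
  finally have card: "card ?F \<le> J" by (simp only: power_increasing_iff)
  have "(\<Sum>r\<in>R. 1 / real r) \<le> (\<Sum>r\<in>R. \<Sum>p\<in>?F. of_bool (p dvd r) / real r)"
  proof (rule sum_mono)
    fix r assume r: "r \<in> R"
    have "gcd r s \<noteq> 1" using cop[OF r s] coprime_iff_gcd_eq_1 by blast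
    then obtain p where p: "prime p" "p dvd gcd r s" using prime_factor_nat by blast
    then have pF: "p \<in> ?F" "p dvd r" using R(2)[OF s] by (auto simp: smooth_on_def in_prime_factors_iff)
    then show "1 / real r \<le> (\<Sum>p\<in>?F. of_bool (p dvd r) / real r)"
      using member_le_sum[of p ?F "\<lambda>p. of_bool (p dvd r) / real r"] by simp
  qed
  also have "\<dots> = (\<Sum>p\<in>?F. \<Sum>r\<in>R. of_bool (p dvd r) / real r)" by (rule sum.swap)
  also have "\<dots> \<le> (\<Sum>p\<in>?F. euler_prod S / real z)"
  proof (rule sum_mono)
    fix p assume p: "p \<in> ?F"
    then have "p \<in> S" using R(2)[OF s] by (auto simp: smooth_on_def)
    then have pS: "p > z" "prime p" using S(2) by auto
    then have p0: "p > 0" by simp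
    define D where "D = (\<lambda>r. r div p) ` {r\<in>R. p dvd r}"
    have inj: "inj_on (\<lambda>r. r div p) {r\<in>R. p dvd r}"
      using p0 by (auto intro!: inj_onI elim!: dvdE)
    have "(\<Sum>r\<in>R. of_bool (p dvd r) / real r) = (\<Sum>r\<in>{r\<in>R. p dvd r}. 1 / real r)"
      using R(1) by (intro sum.mono_neutral_cong_right) auto
    also have "\<dots> = 1 / real p * (\<Sum>r\<in>{r\<in>R. p dvd r}. 1 / real (r div p))"
      unfolding sum_distrib_left by (intro sum.cong refl) (use p0 in \<open>auto elim!: dvdE\<close>)
    also have "\<dots> = 1 / real p * (\<Sum>k\<in>D. 1 / real k)"
      unfolding D_def by (simp add: sum.reindex[OF inj])
    also have "\<dots> \<le> 1 / real p * euler_prod S"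
    proof (intro mult_left_mono euler_prod_smooth_sum)
      fix k assume "k \<in> D"
      then obtain r where r: "r \<in> R" "p dvd r" "k = r div p" unfolding D_def by blast
      then have rk: "r = p * k" by simp
      have r0: "r > 0" "prime_factors r \<subseteq> S" using R(2)[OF r(1)] by (auto simp: smooth_on_def)
      then have "k > 0" using rk by (metis gr0I mult_0_right less_irrefl)
      moreover have "prime_factors k \<subseteq> prime_factors r"
        by (rule dvd_prime_factors) (use rk r0 in auto)
      ultimately show "smooth_on S k" using r0 by (auto simp: smooth_on_def)
    qed (use S R in \<open>auto simp: D_def\<close>)
    also have "\<dots> \<le> euler_prod S / real z"
      using pS z EP by (simp add: frac_le)
    finally show "(\<Sum>r\<in>R. of_bool (p dvd r) / real r) \<le> euler_prod S / real z" .
  qed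
  also have "\<dots> = real (card ?F) * (euler_prod S / real z)" by simp
  also have "\<dots> \<le> real J * (euler_prod S / real z)" using card EP by (intro mult_right_mono) auto
  finally show ?thesis by simp
qed

text \<open>The Euler product over the new primes, from \<open>intersecting_family_sum_le\<close>,
  and the one over the old primes, from the sieve, multiply to the one over all primes up to
  \<open>y\<close>, which is only a power of \<open>ln y\<close>.\<close>

lemma uncovered_medium_primes:
  assumes M: "disjoint_classes M a" "finite M" "\<And>m. m \<in> M \<Longrightarrow> m dvd N" "N > 0"
    and J: "\<And>m. m \<in> M \<Longrightarrow> m \<le> 2 ^ J" and z: "0 < z" "z \<le> y"
    and big: "2 * real J * euler_prod (primes_upto y) \<le> real z"
  shows "1 / 2 * avg N (\<lambda>x. of_bool (uncovered (smooth_part (primes_upto z) M) a x))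
    \<le> avg N (\<lambda>x. of_bool (uncovered (smooth_part (primes_upto y) M) a x))"
proof -
  let ?Z = "primes_upto z" and ?S = "primes_upto y"
  let ?A = "avg N (\<lambda>x. of_bool (uncovered (smooth_part ?Z M) a x))"
  define c where "c = real J * euler_prod (?S - ?Z) / real z"
  have ZS: "?Z \<subseteq> ?S" using z by (auto simp: primes_upto_def)
  have "euler_prod ?S = euler_prod (?S - ?Z) * euler_prod ?Z"
    unfolding euler_prod_def by (rule prod.subset_diff[OF ZS]) simp
  then have "c * euler_prod ?Z = real J * euler_prod ?S / real z" by (simp add: c_def)
  also have "\<dots> \<le> 1 / 2" using big z by (simp add: field_simps)
  finally have "1 / 2 \<le> 1 - c * euler_prod ?Z" by simp
  then have "1 / 2 * ?A \<le> (1 - c * euler_prod ?Z) * ?A"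
    by (intro mult_right_mono avg_nonneg) auto
  also have "\<dots> \<le> avg N (\<lambda>x. of_bool (uncovered (smooth_part ?S M) a x))"
  proof (rule disjoint_classes_sieve[OF M])
    fix R :: "nat set" assume R: "finite R" "\<And>r. r \<in> R \<Longrightarrow> smooth_on (?S - ?Z) r \<and> r > 1 \<and> (\<exists>m\<in>M. r dvd m)"
      "\<And>r s. r \<in> R \<Longrightarrow> s \<in> R \<Longrightarrow> \<not> coprime r s"
    show "(\<Sum>r\<in>R. 1 / real r) \<le> c" unfolding c_def
    proof (rule intersecting_family_sum_le[OF _ _ z(1) R(1) _ R(3)])
      fix r assume "r \<in> R"
      then obtain m where m: "m \<in> M" "r dvd m" "smooth_on (?S - ?Z) r" using R(2) by blast
      have "m > 0" using M(3)[OF m(1)] M(4) by (auto intro: Nat.gr0I)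
      then have "r \<le> m" using m(2) by (rule dvd_imp_le[rotated])
      then show "smooth_on (?S - ?Z) r \<and> r \<le> 2 ^ J" using m J by force
    qed (auto simp: primes_upto_def)
  qed (use ZS in \<open>auto simp: primes_upto_def\<close>)
  finally show ?thesis .
qed

section \<open>Rankin's bound for large smooth moduli\<close>

lemma smooth_tail_sum_le:
  assumes K: "2 \<le> K" and D: "finite D" "\<And>m. m \<in> D \<Longrightarrow> smooth_on (primes_upto (2 ^ K)) m \<and> m > 2 ^ (K * K)"
  shows "(\<Sum>m\<in>D. 1 / real m) \<le> 36 * real K ^ 12 / 2 ^ K"
proof -
  \<comment> \<open>Rankin's trick: \<open>1 / m \<le> 2 ^ (- K) * m powr (s - 1)\<close> for \<open>m > 2 ^ (K * K)\<close>\<close>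
  define s where "s = 1 / real K"
  have s: "0 < s" "s \<le> 1 / 2" using K by (auto simp: s_def field_simps)
  define f where "f = (\<lambda>m::nat. real m powr (s - 1))"
  have fp: "0 \<le> f p" "f p \<le> 2 / real p" if "prime p" "p \<le> 2 ^ K" for p
  proof -
    have p0: "real p > 0" using prime_gt_0_nat[OF that(1)] by simp
    have "real p \<le> 2 ^ K" using that(2) by (metis of_nat_le_iff of_nat_numeral of_nat_power)
    then have "real p powr s \<le> (2 ^ K) powr s" using s p0 by (intro powr_mono2) auto
    also have "\<dots> = 2" using K by (simp add: s_def powr_realpow[symmetric] powr_powr)
    finally have "real p powr s / real p \<le> 2 / real p" by (simp add: divide_right_mono)
    then show "f p \<le> 2 / real p" using p0 by (simp add: f_def powr_diff)
  qed (simp add: f_def)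
  \<comment> \<open>At 2 the bound \<open>f p \<le> 2 / p\<close> gives only 1;
    \<open>s \<le> 1 / 2\<close> gives \<open>1 / sqrt 2\<close> instead.\<close>
  have f2: "f 2 \<le> 3 / 4"
  proof -
    have "f 2 \<le> 2 powr (- (1 / 2))" unfolding f_def using s by (auto intro: powr_mono)
    also have "\<dots> = inverse (2 powr (1 / 2))" by (rule powr_minus)
    also have "\<dots> = 1 / sqrt 2" by (simp only: powr_half_sqrt[of 2, simplified] inverse_eq_divide)
    also have "\<dots> \<le> 3 / 4"
    proof -
      have "4 / 3 \<le> sqrt (2::real)" by (rule real_le_rsqrt) (simp add: power2_eq_square)
      then show ?thesis by (simp add: field_simps)
    qed
    finally show ?thesis .
  qed
  have f1: "f p < 1" if "prime p" "p \<le> 2 ^ K" for p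
  proof (cases "p = 2")
    case False
    then have "p \<ge> 3" using prime_ge_2_nat[OF that(1)] by auto
    then have "2 / real p < 1" by simp
    then show ?thesis using fp[OF that] by linarith
  qed (use f2 in auto)
  have "(\<Sum>m\<in>D. f m) \<le> (\<Prod>p\<in>primes_upto (2 ^ K). 1 / (1 - f p))"
    by (rule smooth_sum_le) (use D f1 in \<open>auto simp: primes_upto_def f_def powr_mult\<close>)
  \<comment> \<open>The 6 comes from \<open>2 / (p - 2) \<le> 6 / p\<close> for
    \<open>p \<ge> 3\<close>, with equality at 3.\<close>
  also have "\<dots> \<le> 1 / (1 - f 2) * exp (6 / 3) * real K powr (2 * 6)"
  proof (rule prod_primes_upto_le[OF K])
    fix p :: nat assume p: "prime p" "p \<le> 2 ^ K"
    show "0 \<le> 1 / (1 - f p)" using f1[OF p] by simp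
    assume "p \<ge> 3"
    then have p3: "real p \<ge> 3" by simp
    have "1 / (1 - f p) \<le> 1 / (1 - 2 / real p)" using fp[OF p] p3 by (intro frac_le) auto
    also have "\<dots> = 1 + 2 / (real p - 2)" using p3 by (simp add: field_simps)
    also have "\<dots> \<le> exp (2 / (real p - 2))" by (rule exp_ge_add_one_self)
    also have "\<dots> \<le> exp (6 / real p)" using p3 by (simp add: field_simps)
    finally show "1 / (1 - f p) \<le> exp (6 / real p)" .
  qed simp
  also have "\<dots> \<le> 4 * 9 * real K powr 12"
  proof (intro mult_mono)
    show "1 / (1 - f 2) \<le> 4" using f2 by (simp add: field_simps)
    have "exp (6 / 3 :: real) = exp 1 ^ 2" by (simp add: power2_eq_square flip: exp_add)
    also have "\<dots> \<le> 3 ^ 2" using exp_le by (intro power_mono) auto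
    finally show "exp (6 / 3 :: real) \<le> 9" by simp
  qed (use f2 in auto)
  also have "\<dots> = 36 * real K ^ 12" using K by simp
  finally have F: "(\<Sum>m\<in>D. f m) \<le> 36 * real K ^ 12" .
  have "(\<Sum>m\<in>D. 1 / real m) \<le> (\<Sum>m\<in>D. f m / 2 ^ K)"
  proof (rule sum_mono)
    fix m assume m: "m \<in> D"
    have m0: "real m > 0" using D(2)[OF m] by (simp add: smooth_on_def)
    have "real (2 ^ (K * K)) \<le> real m" using D(2)[OF m] by (intro of_nat_mono) auto
    then have "(2 ^ (K * K)) powr s \<le> real m powr s" using s by (intro powr_mono2) auto
    moreover have "(2 ^ (K * K)) powr s = (2::real) ^ K"
      using K by (simp add: s_def powr_realpow[symmetric] powr_powr)
    ultimately have "2 ^ K / real m \<le> f m" using m0 by (simp add: f_def powr_diff divide_right_mono)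
    then show "1 / real m \<le> f m / 2 ^ K" by (simp add: field_simps)
  qed
  also have "\<dots> = (\<Sum>m\<in>D. f m) / 2 ^ K" by (simp add: sum_divide_distrib)
  also have "\<dots> \<le> 36 * real K ^ 12 / 2 ^ K" using F by (intro divide_right_mono) auto
  finally show ?thesis .
qed

section \<open>The distortion method\<close>

text \<open>
  The bound for the mass of a class modulo \<open>m\<close> under the distorted weights: each prime factor
  beyond \<open>y\<close> costs a factor of 2.
\<close>

definition distortion_weight :: "nat \<Rightarrow> nat \<Rightarrow> real" where
  "distortion_weight y m = 2 ^ card {p \<in> prime_factors m. y < p} / real m"

lemma distortion_weight_nonneg: "0 \<le> distortion_weight y m"
  by (simp add: distortion_weight_def)

lemma distortion_weight_ge: "1 / real m \<le> distortion_weight y m"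
  by (simp add: distortion_weight_def divide_right_mono)

lemma prime_factors_mult_prime_power:
  fixes m p :: nat
  assumes "prime p" "m > 0" "k > 0"
  shows "prime_factors (m * p ^ k) = insert p (prime_factors m)"
proof -
  have "prime_factors (m * p ^ k) = prime_factors m \<union> prime_factors (p ^ k)"
    using assms by (intro prime_factors_product) auto
  also have "prime_factors (p ^ k) = {p}" using assms by (simp add: prime_factors_power prime_prime_factors)
  finally show ?thesis by simp
qed

lemma distortion_weight_mult_prime_power:
  assumes "prime p" "coprime p m" "m > 0"
  shows "distortion_weight y (m * p ^ k)
    = distortion_weight y m * (if k = 0 then 1 else (if y < p then 2 else 1) * (1 / real p) ^ k)"
proof (cases "k = 0")
  case False
  have p: "p \<notin> prime_factors m" using assms by (metis coprime_absorb_left in_prime_factors_imp_dvd not_prime_unit)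
  have eq: "{q \<in> prime_factors (m * p ^ k). y < q} = (if y < p then insert p {q \<in> prime_factors m. y < q} else {q \<in> prime_factors m. y < q})"
    using prime_factors_mult_prime_power[OF assms(1,3), of k] False by auto
  show ?thesis using False p unfolding distortion_weight_def eq
    by (simp add: power_one_over)
qed simp

text \<open>The second moment of the covered fraction runs over pairs of classes modulo
  \<open>d\<close> and \<open>e\<close>, which meet in at most one class modulo
  \<open>lcm d e\<close>; this sum bounds the part contributed by the old primes.\<close>

definition divisor_pair_sum :: "nat \<Rightarrow> nat \<Rightarrow> real" where
  "divisor_pair_sum y Q = (\<Sum>d\<in>{d. d dvd Q}. \<Sum>e\<in>{e. e dvd Q}. distortion_weight y (lcm d e))"

text \<open>The Euler factor of \<open>divisor_pair_sum\<close> at \<open>p\<close>: a value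
  \<open>k\<close> is the maximum of \<open>2 * k + 1\<close> pairs of exponents, and summing
  \<open>(2 * k + 1) / p ^ k\<close> over \<open>k \<ge> 1\<close> gives
  \<open>(3 * p - 1) / (p - 1) ^ 2\<close>.\<close>

definition pair_factor :: "nat \<Rightarrow> nat \<Rightarrow> real" where
  "pair_factor y p = 1 + (if y < p then 2 else 1) * (3 * real p - 1) / (real p - 1)\<^sup>2"

lemma coprime_lcm:
  fixes p d e :: nat
  assumes "coprime p d" "coprime p e"
  shows "coprime p (lcm d e)"
proof -
  have "coprime p (d * e)" using assms by simp
  then show ?thesis by (rule coprime_divisors[rotated 2]) (auto intro: lcm_least)
qed

lemma lcm_mult_prime_power:
  fixes p d e :: nat
  assumes "prime p" "coprime p d" "coprime p e" "d > 0" "e > 0"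
  shows "lcm (d * p ^ i) (e * p ^ j) = lcm d e * p ^ max i j"
proof -
  have pp: "i \<le> j \<Longrightarrow> lcm (p ^ i) (p ^ j) = p ^ j" "j \<le> i \<Longrightarrow> lcm (p ^ i) (p ^ j) = p ^ i" for i j
    by (auto simp: lcm_proj2_if_dvd lcm_proj1_if_dvd le_imp_power_dvd)
  have "lcm (d * p ^ i) (e * p ^ j) = lcm (lcm d (p ^ i)) (lcm e (p ^ j))"
    using assms by (simp add: lcm_coprime coprime_commute)
  also have "\<dots> = lcm (lcm d e) (lcm (p ^ i) (p ^ j))" by (simp add: lcm.assoc lcm.left_commute)
  also have "lcm (p ^ i) (p ^ j) = p ^ max i j" using pp by (cases "i \<le> j") (auto simp: max_def)
  also have "lcm (lcm d e) (p ^ max i j) = lcm d e * p ^ max i j"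
  proof -
    have "coprime (lcm d e) (p ^ max i j)"
      using coprime_lcm[OF assms(2,3)] by (simp add: coprime_commute)
    then show ?thesis by (simp add: lcm_coprime)
  qed
  finally show ?thesis .
qed

lemma divisors_mult_prime_power:
  fixes p Q :: nat
  assumes "prime p" "coprime p Q" "Q > 0"
  shows "bij_betw (\<lambda>(d, i). d * p ^ i) ({d. d dvd Q} \<times> {..c}) {d. d dvd Q * p ^ c}"
proof (rule bij_betw_imageI)
  have mult: "multiplicity p (d * p ^ i) = i" if "d dvd Q" for d i
  proof -
    have "coprime p d" using assms(2) that by (metis coprime_divisors dvd_refl)
    then have nd: "\<not> p dvd d" using assms(1) by (metis coprime_absorb_left not_prime_unit)
    have "d > 0" using that assms(3) by (auto intro: Nat.gr0I)
    then show ?thesis using assms(1) nd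
      by (simp add: prime_elem_multiplicity_mult_distrib multiplicity_same_power not_dvd_imp_multiplicity_0 prime_imp_prime_elem)
  qed
  show "inj_on (\<lambda>(d, i). d * p ^ i) ({d. d dvd Q} \<times> {..c})"
  proof (rule inj_onI, clarify)
    fix d i e j assume "d dvd Q" "e dvd Q" "d * p ^ i = e * p ^ j"
    then show "d = e \<and> i = j" using mult[of d i] mult[of e j] prime_gt_0_nat[OF assms(1)] by auto
  qed
  show "(\<lambda>(d, i). d * p ^ i) ` ({d. d dvd Q} \<times> {..c}) = {d. d dvd Q * p ^ c}"
  proof (intro equalityI subsetI)
    fix m assume "m \<in> (\<lambda>(d, i). d * p ^ i) ` ({d. d dvd Q} \<times> {..c})"
    then show "m \<in> {d. d dvd Q * p ^ c}" by (auto intro!: mult_dvd_mono le_imp_power_dvd)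
  next
    fix m assume "m \<in> {d. d dvd Q * p ^ c}"
    then have m: "m dvd Q * p ^ c" by simp
    then obtain d e where de: "m = d * e" "d dvd Q" "e dvd p ^ c" using division_decomp by blast
    obtain i where "i \<le> c" "e = p ^ i" using de(3) divides_primepow_nat[OF assms(1)] by blast
    then show "m \<in> (\<lambda>(d, i). d * p ^ i) ` ({d. d dvd Q} \<times> {..c})" using de by (intro image_eqI[of _ _ "(d, i)"]) auto
  qed
qed

lemma sum_max_powers_le:
  fixes x g :: real
  assumes "0 < x" "x < 1" "0 \<le> g"
  shows "(\<Sum>i\<le>c. \<Sum>j\<le>c. (if max i j = 0 then 1 else g * x ^ max i j)) \<le> 1 + g * (x * (3 - x) / (1 - x)\<^sup>2)"
proof -
  define s where "s = (\<lambda>k::nat. if k = 0 then 1 else g * x ^ k)"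
  \<comment> \<open>the tail of the series \<open>\<Sum> (2 * k + 1) * x ^ k\<close> over \<open>k > c\<close>, in closed form\<close>
  define r where "r = (\<lambda>c::nat. x ^ (c + 1) * ((2 * real c + 3) - (2 * real c + 1) * x) / (1 - x)\<^sup>2)"
  have rstep: "r c = (2 * real c + 3) * x ^ (c + 1) + r (Suc c)" for c
  proof -
    have "r c * (1 - x)\<^sup>2 = ((2 * real c + 3) * x ^ (c + 1) + r (Suc c)) * (1 - x)\<^sup>2"
      using assms unfolding r_def
      by (simp add: distrib_right) (simp add: power2_eq_square algebra_simps)
    then show ?thesis using assms by simp
  qed
  have "(\<Sum>i\<le>c. \<Sum>j\<le>c. s (max i j)) = 1 + g * (x * (3 - x) / (1 - x)\<^sup>2) - g * r c"
  proof (induction c)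
    case 0
    show ?case by (simp add: s_def r_def)
  next
    case (Suc c)
    have "(\<Sum>i\<le>Suc c. \<Sum>j\<le>Suc c. s (max i j)) = (\<Sum>i\<le>c. \<Sum>j\<le>c. s (max i j)) + (\<Sum>i\<le>c. s (max i (Suc c))) + (\<Sum>j\<le>Suc c. s (max (Suc c) j))"
      by (simp add: sum.distrib)
    also have "(\<Sum>i\<le>c. s (max i (Suc c))) = real (Suc c) * (g * x ^ Suc c)"
      by (simp add: s_def max_def)
    also have "(\<Sum>j\<le>Suc c. s (max (Suc c) j)) = real (Suc (Suc c)) * (g * x ^ Suc c)"
      by (simp add: s_def max_def cong: sum.cong_simp)
    finally show ?case using Suc.IH rstep[of c] by (simp add: algebra_simps)
  qed
  moreover have "0 \<le> r c"
  proof -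
    have "0 \<le> (2 * real c + 1) * (1 - x) + 2" using assms by (intro add_nonneg_nonneg mult_nonneg_nonneg) auto
    also have "\<dots> = (2 * real c + 3) - (2 * real c + 1) * x" by (simp add: algebra_simps)
    finally have "0 \<le> (2 * real c + 3) - (2 * real c + 1) * x" .
    then show ?thesis using assms unfolding r_def by (intro divide_nonneg_nonneg mult_nonneg_nonneg) auto
  qed
  ultimately show ?thesis using assms(3) unfolding s_def by simp
qed

text \<open>\<open>lcm\<close> takes the maximum of the two exponents of \<open>p\<close>, so the
  sum over pairs factors exactly; only the truncation of the exponents at \<open>c\<close> makes
  this an inequality.\<close>

lemma divisor_pair_sum_mult_prime_power:
  assumes "prime p" "coprime p Q" "Q > 0"
  shows "divisor_pair_sum y (Q * p ^ c) \<le> divisor_pair_sum y Q * pair_factor y p"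
proof -
  define g :: real where "g = (if y < p then 2 else 1)"
  define s where "s = (\<lambda>k::nat. if k = 0 then 1 else g * (1 / real p) ^ k)"
  let ?D = "{d. d dvd Q}"
  have fin: "finite ?D" using assms(3) by simp
  have D: "d > 0" "coprime p d" if "d \<in> ?D" for d
    using that assms coprime_divisors[of p p d Q] by (auto intro: Nat.gr0I)
  have p1: "real p > 1" using prime_gt_1_nat[OF assms(1)] by simp
  have re: "(\<Sum>d\<in>{d. d dvd Q * p ^ c}. h d) = (\<Sum>d\<in>?D. \<Sum>i\<le>c. h (d * p ^ i))" for h :: "nat \<Rightarrow> real"
  proof -
    have "(\<Sum>d\<in>{d. d dvd Q * p ^ c}. h d) = (\<Sum>z\<in>?D \<times> {..c}. h (case z of (d, i) \<Rightarrow> d * p ^ i))"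
      by (rule sum.reindex_bij_betw[OF divisors_mult_prime_power[OF assms], symmetric])
    also have "\<dots> = (\<Sum>(d, i)\<in>?D \<times> {..c}. h (d * p ^ i))" by (intro sum.cong) auto
    finally show ?thesis by (simp add: sum.cartesian_product)
  qed
  have "divisor_pair_sum y (Q * p ^ c)
      = (\<Sum>d\<in>?D. \<Sum>i\<le>c. \<Sum>e\<in>?D. \<Sum>j\<le>c. distortion_weight y (lcm (d * p ^ i) (e * p ^ j)))"
    unfolding divisor_pair_sum_def re ..
  also have "\<dots> = (\<Sum>d\<in>?D. \<Sum>i\<le>c. \<Sum>e\<in>?D. \<Sum>j\<le>c. distortion_weight y (lcm d e) * s (max i j))"
  proof (intro sum.cong refl)
    fix d i e j assume de: "d \<in> ?D" "e \<in> ?D"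
    have "lcm (d * p ^ i) (e * p ^ j) = lcm d e * p ^ max i j"
      by (rule lcm_mult_prime_power[OF assms(1)]) (use D de in auto)
    moreover have "coprime p (lcm d e)" "lcm d e > 0"
      using D[OF de(1)] D[OF de(2)] by (auto intro: coprime_lcm lcm_pos_nat)
    ultimately show "distortion_weight y (lcm (d * p ^ i) (e * p ^ j)) = distortion_weight y (lcm d e) * s (max i j)"
      using distortion_weight_mult_prime_power[OF assms(1), of "lcm d e" y "max i j"] by (simp add: s_def g_def)
  qed
  also have "\<dots> = (\<Sum>d\<in>?D. \<Sum>e\<in>?D. \<Sum>i\<le>c. \<Sum>j\<le>c. distortion_weight y (lcm d e) * s (max i j))"
    by (intro sum.cong refl sum.swap)
  also have "\<dots> = divisor_pair_sum y Q * (\<Sum>i\<le>c. \<Sum>j\<le>c. s (max i j))"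
    unfolding divisor_pair_sum_def sum_distrib_left[symmetric] sum_distrib_right[symmetric] ..
  also have "\<dots> \<le> divisor_pair_sum y Q * pair_factor y p"
  proof (rule mult_left_mono)
    have "(\<Sum>i\<le>c. \<Sum>j\<le>c. s (max i j)) \<le> 1 + g * ((1 / real p) * (3 - 1 / real p) / (1 - 1 / real p)\<^sup>2)"
      unfolding s_def by (rule sum_max_powers_le) (use p1 in \<open>auto simp: g_def\<close>)
    also have "(1 / real p) * (3 - 1 / real p) / (1 - 1 / real p)\<^sup>2 = (3 * real p - 1) / (real p - 1)\<^sup>2"
      using p1 by (simp add: power2_eq_square divide_simps)
    finally show "(\<Sum>i\<le>c. \<Sum>j\<le>c. s (max i j)) \<le> pair_factor y p" by (simp add: pair_factor_def g_def)
  qed (auto simp: divisor_pair_sum_def distortion_weight_nonneg intro!: sum_nonneg)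
  finally show ?thesis .
qed

lemma part_on_atMost_Suc:
  assumes "N > 0"
  shows "part_on {..Suc n} N = part_on {..n} N * Suc n ^ count (prime_factorization N) (Suc n)"
proof -
  let ?F = "prime_factorization N"
  have "{#p \<in># ?F. p \<in> {..Suc n}#} = {#p \<in># ?F. p \<in> {..n}#} + {#p \<in># ?F. p = Suc n#}"
    by (rule multiset_eqI) (auto simp: le_Suc_eq)
  also have "{#p \<in># ?F. p = Suc n#} = replicate_mset (count ?F (Suc n)) (Suc n)"
    by (rule filter_eq_replicate_mset)
  finally show ?thesis by (simp add: part_on_def)
qed

lemma coprime_part_on_atMost: "prime (Suc n) \<Longrightarrow> coprime (Suc n) (part_on {..n} N)"
proof -
  assume p: "prime (Suc n)"
  then have "smooth_on {Suc n} (Suc n)" by (simp add: smooth_on_def prime_prime_factors)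
  then show ?thesis by (rule coprime_smooth_on[OF _ smooth_on_part_on]) simp
qed

lemma pair_factor_ge_1: "prime p \<Longrightarrow> 1 \<le> pair_factor y p"
  using prime_gt_1_nat[of p] by (simp add: pair_factor_def)

lemma divisor_pair_sum_le:
  assumes "N > 0"
  shows "divisor_pair_sum y (part_on {..n} N) \<le> (\<Prod>p\<in>primes_upto n. pair_factor y p)"
proof (induction n)
  case 0
  have "{#p \<in># prime_factorization N. p \<in> {..0}#} = {#}"
    using prime_gt_0_nat[OF in_prime_factors_imp_prime] by auto
  then have "part_on {..0} N = 1" by (simp only: part_on_def prod_mset_empty)
  moreover have "primes_upto 0 = {}" by (auto simp: primes_upto_def)
  ultimately show ?case by (simp add: divisor_pair_sum_def distortion_weight_def)
next
  case (Suc n)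
  show ?case
  proof (cases "prime (Suc n)")
    case True
    have ins: "primes_upto (Suc n) = insert (Suc n) (primes_upto n)" using True by (auto simp: primes_upto_def le_Suc_eq)
    have new: "Suc n \<notin> primes_upto n" by (simp add: primes_upto_def)
    have "divisor_pair_sum y (part_on {..Suc n} N) \<le> divisor_pair_sum y (part_on {..n} N) * pair_factor y (Suc n)"
      unfolding part_on_atMost_Suc[OF assms]
      by (rule divisor_pair_sum_mult_prime_power[OF True coprime_part_on_atMost[OF True] part_on_pos])
    also have "\<dots> \<le> (\<Prod>p\<in>primes_upto n. pair_factor y p) * pair_factor y (Suc n)"
      using Suc.IH pair_factor_ge_1[OF True, of y] by (intro mult_right_mono) auto
    finally show ?thesis unfolding ins using new by (simp add: mult.commute)
  next
    case False
    then have "primes_upto (Suc n) = primes_upto n" by (auto simp: primes_upto_def le_Suc_eq)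
    moreover have "part_on {..Suc n} N = part_on {..n} N"
      using part_on_atMost_Suc[OF assms, of n] False by (simp add: count_prime_factorization_nonprime)
    ultimately show ?thesis using Suc.IH by simp
  qed
qed

lemma prod_pair_factor_le:
  assumes "K \<ge> 2" "y \<ge> 2"
  shows "(\<Prod>p\<in>primes_upto (2 ^ K). pair_factor y p) \<le> 486 * real K ^ 24"
proof -
  have "(\<Prod>p\<in>primes_upto (2 ^ K). pair_factor y p) \<le> pair_factor y 2 * exp (12 / 3) * real K powr (2 * 12)"
  proof (rule prod_primes_upto_le[OF assms(1)])
    fix p :: nat assume p: "prime p"
    show "0 \<le> pair_factor y p" using pair_factor_ge_1[OF p, of y] by simp
    assume "p \<ge> 3"
    then have p3: "real p \<ge> 3" by simp
    \<comment> \<open>This product is \<open>6 * (p - 1) ^ 2 - (3 * p - 1) * p\<close>.\<close>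
    have "0 \<le> (3 * real p - 2) * (real p - 3)" using p3 by simp
    then have "(3 * real p - 1) * real p \<le> 6 * (real p - 1)\<^sup>2" by (simp add: power2_eq_square algebra_simps)
    then have "(3 * real p - 1) / (real p - 1)\<^sup>2 \<le> 6 / real p" using p3 by (simp add: divide_simps mult.commute)
    moreover have "0 \<le> (3 * real p - 1) / (real p - 1)\<^sup>2" using p3 by simp
    ultimately have "(if y < p then 2 else 1) * ((3 * real p - 1) / (real p - 1)\<^sup>2) \<le> 2 * (6 / real p)"
      by (intro mult_mono) auto
    then have "pair_factor y p \<le> 1 + 12 / real p" unfolding pair_factor_def by simp
    also have "\<dots> \<le> exp (12 / real p)" by (rule exp_ge_add_one_self)
    finally show "pair_factor y p \<le> exp (12 / real p)" .
  qed simp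
  also have "\<dots> \<le> 6 * 81 * real K powr 24"
  proof (intro mult_mono)
    \<comment> \<open>\<open>y \<ge> 2\<close> exempts the prime 2 from the doubling, so the value
      is exactly 6.\<close>
    show "pair_factor y 2 \<le> 6" using assms(2) by (simp add: pair_factor_def)
    have "exp (12 / 3 :: real) = exp 1 ^ 4" by (simp flip: exp_of_nat_mult)
    also have "\<dots> \<le> 3 ^ 4" using exp_le by (intro power_mono) auto
    finally show "exp (12 / 3 :: real) \<le> 81" by simp
  qed auto
  also have "\<dots> = 486 * real K ^ 24" using assms(1) by simp
  finally show ?thesis .
qed

section \<open>One step of the distortion method\<close>

lemma periodic_avg_fibre:
  assumes g: "periodic (Q * P) g" and "P > 0"
  shows "periodic Q (\<lambda>x. avg P (\<lambda>y. g (x + int Q * y)))"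
  unfolding periodic_def
proof (intro allI impI)
  fix x x' assume "[x = x'] (mod int Q)"
  then obtain k where k: "x = x' + int Q * k" by (metis cong_iff_lin cong_sym)
  have per: "periodic P (\<lambda>y. g (x' + int Q * y))"
    unfolding periodic_def
  proof (intro allI impI)
    fix y y' assume "[y = y'] (mod int P)"
    then have "[int Q * y = int Q * y'] (mod int Q * int P)" by (auto simp: cong_iff_dvd_diff right_diff_distrib[symmetric])
    then show "g (x' + int Q * y) = g (x' + int Q * y')"
      by (intro periodicD[OF g]) (auto intro: cong_add)
  qed
  have "avg P (\<lambda>y. g (x + int Q * y)) = avg P (\<lambda>y. g (x' + int Q * (k + y)))"
    by (simp add: k algebra_simps)
  also have "\<dots> = avg P (\<lambda>y. g (x' + int Q * y))" by (rule avg_shift[OF per \<open>P > 0\<close>])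
  finally show "avg P (\<lambda>y. g (x + int Q * y)) = avg P (\<lambda>y. g (x' + int Q * y))" .
qed

text \<open>As \<open>y\<close> varies, \<open>x + Q * y\<close> stays fixed modulo \<open>m\<close>
  and is uniformly distributed modulo \<open>p ^ f\<close>, because \<open>Q\<close> is invertible
  there.\<close>

lemma avg_class_fibre:
  assumes "prime p" "coprime p Q" "m dvd Q" "f \<le> c"
  shows "avg (p ^ c) (\<lambda>y. of_bool ([x + int Q * y = b] (mod int (m * p ^ f))))
    = of_bool ([x = b] (mod int m)) * (1 / real p) ^ f"
proof -
  have "coprime (int Q) (int (p ^ f))" using assms(2) by (simp add: coprime_commute)
  then obtain u where u: "[int Q * u = 1] (mod int (p ^ f))" using cong_solve_coprime_int by blast
  have cop: "coprime (int m) (int (p ^ f))" using assms(2,3) coprime_divisors[of p p m Q] by (simp add: coprime_commute)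
  have 1: "[x + int Q * y = b] (mod int m) \<longleftrightarrow> [x = b] (mod int m)" for y
  proof -
    have "[x + int Q * y = x + 0] (mod int m)"
      using assms(3) by (intro cong_add cong_refl) (simp add: cong_0_iff)
    then show ?thesis by (metis add.right_neutral cong_sym cong_trans)
  qed
  have 2: "[x + int Q * y = b] (mod int (p ^ f)) \<longleftrightarrow> [y = u * (b - x)] (mod int (p ^ f))" for y
  proof
    assume h: "[x + int Q * y = b] (mod int (p ^ f))"
    have "[y = (int Q * u) * y] (mod int (p ^ f))" using cong_mult[OF u cong_refl[of y]] by (simp add: cong_sym)
    also have "(int Q * u) * y = u * ((x + int Q * y) - x)" by (simp add: algebra_simps)
    also have "[u * ((x + int Q * y) - x) = u * (b - x)] (mod int (p ^ f))"
      by (intro cong_mult cong_diff cong_refl h)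
    finally show "[y = u * (b - x)] (mod int (p ^ f))" .
  next
    assume h: "[y = u * (b - x)] (mod int (p ^ f))"
    have "[x + int Q * y = x + int Q * (u * (b - x))] (mod int (p ^ f))"
      by (intro cong_add cong_mult cong_refl h)
    also have "x + int Q * (u * (b - x)) = x + (int Q * u) * (b - x)" by (simp add: mult.assoc)
    also have "[x + (int Q * u) * (b - x) = x + 1 * (b - x)] (mod int (p ^ f))"
      by (intro cong_add cong_mult cong_refl u)
    finally show "[x + int Q * y = b] (mod int (p ^ f))" by simp
  qed
  have 3: "[x + int Q * y = b] (mod int (m * p ^ f)) \<longleftrightarrow> [x = b] (mod int m) \<and> [y = u * (b - x)] (mod int (p ^ f))" for y
  proof -
    have "[x + int Q * y = b] (mod int (m * p ^ f)) \<longleftrightarrow> [x + int Q * y = b] (mod int m) \<and> [x + int Q * y = b] (mod int (p ^ f))"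
      using coprime_cong_mult[OF _ _ cop] by (auto intro: cong_modulus_mult cong_dvd_modulus[OF _ dvd_triv_right] cong_dvd_modulus[OF _ dvd_triv_left] simp del: of_nat_power)
    then show ?thesis by (simp only: 1 2)
  qed
  have "avg (p ^ c) (\<lambda>y. of_bool ([x + int Q * y = b] (mod int (m * p ^ f))))
    = avg (p ^ c) (\<lambda>y. of_bool ([x = b] (mod int m)) * of_bool ([y = u * (b - x)] (mod int (p ^ f))))"
    unfolding 3 by (simp add: of_bool_conj)
  also have "\<dots> = of_bool ([x = b] (mod int m)) * (1 / real (p ^ f))"
    unfolding avg_cmult using assms prime_gt_0_nat[OF assms(1)]
    by (subst avg_class) (auto simp: le_imp_power_dvd)
  finally show ?thesis by (simp add: power_one_over)
qed

lemma two_classes_le_lcm_class: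
  "\<exists>b. \<forall>x. of_bool ([x = a] (mod int m)) * of_bool ([x = a'] (mod int n)) \<le> (of_bool ([x = b] (mod int (lcm m n))) :: real)"
proof (cases "\<exists>x. [x = a] (mod int m) \<and> [x = a'] (mod int n)")
  case True
  then obtain b where b: "[b = a] (mod int m)" "[b = a'] (mod int n)" by blast
  have "[x = b] (mod int (lcm m n))" if "[x = a] (mod int m)" "[x = a'] (mod int n)" for x
  proof -
    have "int m dvd x - b" "int n dvd x - b"
      using that b by (meson cong_iff_dvd_diff cong_sym cong_trans)+
    then have "lcm (int m) (int n) dvd x - b" by (rule lcm_least)
    then show ?thesis by (simp only: cong_iff_dvd_diff lcm_int_int_eq)
  qed
  then show ?thesis by (intro exI[of _ b]) auto
next
  case False
  then show ?thesis by (intro exI[of _ 0]) auto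
qed

text \<open>The bound on class masses is carried along because it is what estimates the second
  moment at the next prime. Rescaling a fibre that is less than half covered at most doubles the
  weight but leaves its average over the fibre unchanged; so only classes that cut fibres, those
  with \<open>p\<close> dividing \<open>m\<close>, pay the factor 2.\<close>

lemma distortion_step:
  assumes p: "prime p" "coprime p Q" "Q > 0" "c \<ge> 1" "y < p"
    and B: "finite B" "\<And>m. m \<in> B \<Longrightarrow> p dvd m \<and> m dvd Q * p ^ c"
    and w: "periodic Q w" "\<And>x. 0 \<le> w x"
      "\<And>m b. m dvd Q \<Longrightarrow> avg Q (\<lambda>x. w x * of_bool ([x = b] (mod int m))) \<le> distortion_weight y m"
  shows "\<exists>w'. periodic (Q * p ^ c) w' \<and> (\<forall>x. 0 \<le> w' x)
    \<and> (\<forall>x. w' x > 0 \<longrightarrow> w x > 0 \<and> uncovered B a x)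
    \<and> avg (Q * p ^ c) w' \<ge> avg Q w - 4 / (real p - 1)\<^sup>2 * divisor_pair_sum y Q
    \<and> (\<forall>m b. m dvd Q * p ^ c \<longrightarrow>
        avg (Q * p ^ c) (\<lambda>x. w' x * of_bool ([x = b] (mod int m))) \<le> distortion_weight y m)"
proof -
  define P where "P = p ^ c"
  have P0: "P > 0" using prime_gt_0_nat[OF p(1)] by (simp add: P_def)
  have QP0: "Q * P > 0" using P0 p(3) by simp
  define hit where "hit = (\<lambda>x. of_bool (\<not> uncovered B a x) :: real)"
  have hit_per: "periodic (Q * P) hit"
    unfolding hit_def using periodic_uncovered[of B "Q * P" a] B(2) by (intro periodic_comp[where g="\<lambda>t. of_bool (\<not> t)"]) (auto simp: P_def)
  define al where "al = (\<lambda>x. avg P (\<lambda>y. hit (x + int Q * y)))"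
  have al_per: "periodic Q al" unfolding al_def by (rule periodic_avg_fibre[OF hit_per P0])
  have al0: "0 \<le> al x" for x unfolding al_def hit_def by (rule avg_nonneg) simp
  \<comment> \<open>Fibres that are at least half covered are given up; on the others the weight is moved to the
    uncovered part. By Markov's inequality the mass lost is at most four times the second moment.\<close>
  define w' where "w' = (\<lambda>x. w x * (if al x < 1 / 2 then (1 - hit x) / (1 - al x) else 0))"
  have shift: "w (x + int Q * y) = w x" "al (x + int Q * y) = al x" for x y
    by (auto intro!: periodicD[OF w(1)] periodicD[OF al_per] simp: cong_def)
  have w'_per: "periodic (Q * P) w'"
  proof -
    have "periodic (Q * P) w" "periodic (Q * P) al"
      using w(1) al_per by (auto intro: periodic_dvd)
    then show ?thesis using hit_per unfolding w'_def periodic_def by metis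
  qed
  have hit01: "0 \<le> hit x" "hit x \<le> 1" for x by (auto simp: hit_def)
  have w'0: "0 \<le> w' x" for x unfolding w'_def using w(2) hit01 by auto
  have w'2: "w' x \<le> 2 * w x" for x
  proof (cases "al x < 1 / 2")
    case True
    have "(1 - hit x) / (1 - al x) \<le> 1 / (1 / 2)" using True hit01[of x] by (intro frac_le) auto
    then have "w x * ((1 - hit x) / (1 - al x)) \<le> w x * 2" using w(2) by (intro mult_left_mono) auto
    then show ?thesis using True by (simp add: w'_def)
  qed (use w(2)[of x] in \<open>simp add: w'_def\<close>)
  have fibre: "avg P (\<lambda>y. w' (x + int Q * y)) = w x * of_bool (al x < 1 / 2)" for x
  proof (cases "al x < 1 / 2")
    case True
    have "avg P (\<lambda>y. w' (x + int Q * y)) = avg P (\<lambda>y. (w x / (1 - al x)) * (1 - hit (x + int Q * y)))"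
      unfolding w'_def shift using True by simp
    also have "\<dots> = (w x / (1 - al x)) * (1 - al x)"
      by (simp only: avg_cmult avg_diff avg_const[OF P0] al_def)
    finally show ?thesis using True by simp
  next
    case False
    then show ?thesis unfolding w'_def shift by (simp add: avg_def)
  qed
  have pos: "w x > 0 \<and> uncovered B a x" if "w' x > 0" for x
  proof -
    have "w x \<noteq> 0" "hit x \<noteq> 1" using that by (auto simp: w'_def split: if_splits)
    then show ?thesis using w(2)[of x] by (auto simp: hit_def)
  qed
  have class_le: "avg (Q * P) (\<lambda>x. w' x * of_bool ([x = b] (mod int m))) \<le> distortion_weight y m" if m: "m dvd Q * P" for m b
  proof -
    have m0: "m > 0" using m QP0 by (auto intro: Nat.gr0I)
    define f where "f = multiplicity p m"
    define k where "k = prime_free p m"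
    have mk: "m = k * p ^ f" unfolding f_def k_def using prime_free_decomp[of m p] by (simp add: mult.commute)
    have kp: "coprime p k" "k > 0" unfolding k_def using prime_free_coprime[OF p(1) m0] by auto
    have "k dvd Q * p ^ c" using m mk unfolding P_def by (metis dvd_mult_left)
    then have kQ: "k dvd Q" using kp(1) by (simp add: coprime_commute coprime_dvd_mult_left_iff)
    have "p ^ f dvd Q * p ^ c" using m mk unfolding P_def by (metis dvd_mult_right)
    then have "p ^ f dvd p ^ c" using p(2) by (simp add: coprime_dvd_mult_right_iff)
    then have fc: "f \<le> c" using prime_gt_1_nat[OF p(1)] by (simp add: power_dvd_imp_le)
    have wt: "distortion_weight y m = distortion_weight y k * (if f = 0 then 1 else 2 * (1 / real p) ^ f)"
      unfolding mk using distortion_weight_mult_prime_power[OF p(1) kp, of y f] p(5) by simp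
    have "avg (Q * P) (\<lambda>x. w' x * of_bool ([x = b] (mod int m)))
      = avg Q (\<lambda>x. avg P (\<lambda>y. w' (x + int Q * y) * of_bool ([x + int Q * y = b] (mod int m))))"
      by (rule avg_mult)
    also have "\<dots> \<le> avg Q (\<lambda>x. (if f = 0 then 1 else 2 * (1 / real p) ^ f) * (w x * of_bool ([x = b] (mod int k))))"
    proof (rule avg_mono)
      fix x
      have cf: "avg P (\<lambda>y. of_bool ([x + int Q * y = b] (mod int m))) = of_bool ([x = b] (mod int k)) * (1 / real p) ^ f"
        unfolding P_def mk by (rule avg_class_fibre[OF p(1,2) kQ fc])
      show "avg P (\<lambda>y. w' (x + int Q * y) * of_bool ([x + int Q * y = b] (mod int m)))
        \<le> (if f = 0 then 1 else 2 * (1 / real p) ^ f) * (w x * of_bool ([x = b] (mod int k)))"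
      proof (cases "f = 0")
        case True
        then have "m = k" using mk by simp
        have "[x + int Q * y = b] (mod int m) \<longleftrightarrow> [x = b] (mod int k)" for y
          unfolding \<open>m = k\<close> by (rule iffI; erule cong_trans[rotated]) (use kQ in \<open>auto simp: cong_iff_dvd_diff\<close>)
        then have "avg P (\<lambda>y. w' (x + int Q * y) * of_bool ([x + int Q * y = b] (mod int m)))
          = of_bool ([x = b] (mod int k)) * avg P (\<lambda>y. w' (x + int Q * y))"
          unfolding avg_cmult[symmetric] by (simp add: mult.commute)
        also have "\<dots> \<le> of_bool ([x = b] (mod int k)) * w x"
          unfolding fibre using w(2)[of x] by (intro mult_left_mono) auto
        finally show ?thesis using True by (simp add: mult.commute)
      next
        case False
        have "avg P (\<lambda>y. w' (x + int Q * y) * of_bool ([x + int Q * y = b] (mod int m)))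
          \<le> avg P (\<lambda>y. 2 * w x * of_bool ([x + int Q * y = b] (mod int m)))"
          by (intro avg_mono mult_right_mono) (use w'2 shift in \<open>auto\<close>, metis w'2 shift(1))
        also have "\<dots> = 2 * w x * (of_bool ([x = b] (mod int k)) * (1 / real p) ^ f)"
          unfolding avg_cmult cf ..
        finally show ?thesis using False by (simp add: mult_ac)
      qed
    qed
    also have "\<dots> = (if f = 0 then 1 else 2 * (1 / real p) ^ f) * avg Q (\<lambda>x. w x * of_bool ([x = b] (mod int k)))"
      by (rule avg_cmult)
    also have "\<dots> \<le> (if f = 0 then 1 else 2 * (1 / real p) ^ f) * distortion_weight y k"
      using w(3)[OF kQ, of b] by (intro mult_left_mono) auto
    finally show ?thesis using wt by (simp add: mult.commute)
  qed
  have second: "avg Q (\<lambda>x. w x * (al x)\<^sup>2) \<le> (1 / (real p - 1))\<^sup>2 * divisor_pair_sum y Q"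
  proof -
    define k where "k = prime_free p"
    define f where "f = multiplicity p"
    have Bm: "m > 0" "m = k m * p ^ f m" "k m dvd Q" "1 \<le> f m" "f m \<le> c" if "m \<in> B" for m
    proof -
      have m: "m dvd Q * p ^ c" "p dvd m" using B(2)[OF that] by auto
      show m0: "m > 0" using m(1) QP0 unfolding P_def by (auto intro: Nat.gr0I)
      show mk: "m = k m * p ^ f m" unfolding f_def k_def using prime_free_decomp[of m p] by (simp add: mult.commute)
      have kp: "coprime p (k m)" unfolding k_def using prime_free_coprime[OF p(1) m0] by auto
      have "k m dvd Q * p ^ c" using m mk by (metis dvd_mult_left)
      then show "k m dvd Q" using kp by (simp add: coprime_commute coprime_dvd_mult_left_iff)
      have "p ^ f m dvd Q * p ^ c" using m mk by (metis dvd_mult_right)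
      then have "p ^ f m dvd p ^ c" using p(2) by (simp add: coprime_dvd_mult_right_iff)
      then show "f m \<le> c" using prime_gt_1_nat[OF p(1)] by (simp add: power_dvd_imp_le)
      show "1 \<le> f m" unfolding f_def using m(2) m0 p(1) by (simp add: Suc_le_eq prime_multiplicity_gt_zero_iff)
    qed
    define t where "t = (\<lambda>m x. (1 / real p) ^ f m * of_bool ([x = a m] (mod int (k m))) :: real)"
    \<comment> \<open>Union bound: above \<open>x\<close>, a class modulo
      \<open>m = k * p ^ f\<close> fills the proportion \<open>p ^ (- f)\<close> of the fibre or
      nothing.\<close>
    have al_le: "al x \<le> (\<Sum>m\<in>B. t m x)" for x
    proof -
      have "al x \<le> avg P (\<lambda>y. \<Sum>m\<in>B. of_bool ([x + int Q * y = a m] (mod int m)))"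
        unfolding al_def
      proof (rule avg_mono)
        fix y
        show "hit (x + int Q * y) \<le> (\<Sum>m\<in>B. of_bool ([x + int Q * y = a m] (mod int m)))"
        proof (cases "uncovered B a (x + int Q * y)")
          case False
          then obtain m where "m \<in> B" "[x + int Q * y = a m] (mod int m)" by (auto simp: uncovered_def)
          then have "1 \<le> (\<Sum>m\<in>B. of_bool ([x + int Q * y = a m] (mod int m)) :: real)"
            using member_le_sum[of m B "\<lambda>m. of_bool ([x + int Q * y = a m] (mod int m)) :: real"] B(1) by simp
          then show ?thesis using False by (simp add: hit_def)
        qed (simp add: hit_def sum_nonneg)
      qed
      also have "\<dots> = (\<Sum>m\<in>B. avg P (\<lambda>y. of_bool ([x + int Q * y = a m] (mod int m))))" by (rule avg_sum)
      also have "\<dots> = (\<Sum>m\<in>B. t m x)"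
      proof (rule sum.cong[OF refl])
        fix m assume m: "m \<in> B"
        have "avg P (\<lambda>y. of_bool ([x + int Q * y = a m] (mod int (k m * p ^ f m)))) = t m x"
          unfolding P_def t_def avg_class_fibre[OF p(1,2) Bm(3)[OF m] Bm(5)[OF m]] by (rule mult.commute)
        then show "avg P (\<lambda>y. of_bool ([x + int Q * y = a m] (mod int m))) = t m x"
          using Bm(2)[OF m] by simp
      qed
      finally show ?thesis .
    qed
    have "avg Q (\<lambda>x. w x * (al x)\<^sup>2) \<le> avg Q (\<lambda>x. \<Sum>m\<in>B. \<Sum>n\<in>B. w x * (t m x * t n x))"
    proof (rule avg_mono)
      fix x
      have "(al x)\<^sup>2 \<le> (\<Sum>m\<in>B. t m x)\<^sup>2" using al_le al0 by (intro power_mono) auto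
      then have "w x * (al x)\<^sup>2 \<le> w x * (\<Sum>m\<in>B. t m x)\<^sup>2" using w(2) by (intro mult_left_mono) auto
      also have "\<dots> = (\<Sum>m\<in>B. \<Sum>n\<in>B. w x * (t m x * t n x))"
        unfolding power2_eq_square sum_product unfolding sum_distrib_left ..
      finally show "w x * (al x)\<^sup>2 \<le> (\<Sum>m\<in>B. \<Sum>n\<in>B. w x * (t m x * t n x))" .
    qed
    also have "\<dots> = (\<Sum>m\<in>B. \<Sum>n\<in>B. avg Q (\<lambda>x. w x * (t m x * t n x)))"
      by (simp add: avg_sum)
    also have "\<dots> \<le> (\<Sum>m\<in>B. \<Sum>n\<in>B. (1 / real p) ^ f m * (1 / real p) ^ f n * distortion_weight y (lcm (k m) (k n)))"
    proof (intro sum_mono)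
      fix m n assume mn: "m \<in> B" "n \<in> B"
      obtain b where b: "of_bool ([x = a m] (mod int (k m))) * of_bool ([x = a n] (mod int (k n)))
          \<le> (of_bool ([x = b] (mod int (lcm (k m) (k n)))) :: real)" for x
        using two_classes_le_lcm_class[of "a m" "k m" "a n" "k n"] by blast
      have "avg Q (\<lambda>x. w x * (t m x * t n x))
        \<le> avg Q (\<lambda>x. (1 / real p) ^ f m * (1 / real p) ^ f n * (w x * of_bool ([x = b] (mod int (lcm (k m) (k n))))))"
      proof (rule avg_mono)
        fix x
        have "w x * (t m x * t n x) = (1 / real p) ^ f m * (1 / real p) ^ f n * (w x * (of_bool ([x = a m] (mod int (k m))) * of_bool ([x = a n] (mod int (k n)))))"
          by (simp only: t_def mult_ac)
        also have "\<dots> \<le> (1 / real p) ^ f m * (1 / real p) ^ f n * (w x * of_bool ([x = b] (mod int (lcm (k m) (k n)))))"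
          by (intro mult_left_mono b w(2)) simp
        finally show "w x * (t m x * t n x) \<le> (1 / real p) ^ f m * (1 / real p) ^ f n * (w x * of_bool ([x = b] (mod int (lcm (k m) (k n)))))" .
      qed
      also have "\<dots> = (1 / real p) ^ f m * (1 / real p) ^ f n * avg Q (\<lambda>x. w x * of_bool ([x = b] (mod int (lcm (k m) (k n)))))"
        by (rule avg_cmult)
      also have "\<dots> \<le> (1 / real p) ^ f m * (1 / real p) ^ f n * distortion_weight y (lcm (k m) (k n))"
        by (intro mult_left_mono w(3)) (use Bm(3)[OF mn(1)] Bm(3)[OF mn(2)] in \<open>auto intro: lcm_least\<close>)
      finally show "avg Q (\<lambda>x. w x * (t m x * t n x)) \<le> (1 / real p) ^ f m * (1 / real p) ^ f n * distortion_weight y (lcm (k m) (k n))" .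
    qed
    also have "\<dots> \<le> (1 / (real p - 1))\<^sup>2 * divisor_pair_sum y Q"
    proof -
      let ?D = "{d. d dvd Q}" and ?x = "1 / real p"
      have x1: "0 < ?x" "?x < 1" using prime_gt_1_nat[OF p(1)] by auto
      \<comment> \<open>As the moduli are distinct, each pair of old part and exponent occurs at
        most once, and the sums over \<open>B\<close> may be enlarged to all divisors of
        \<open>Q\<close> and all exponents from 1 to \<open>c\<close>. The two geometric sums give
        \<open>1 / (p - 1)\<close> each.\<close>
      have inj: "inj_on (\<lambda>m. (k m, f m)) B"
        by (rule inj_onI) (metis Bm(2) Pair_inject)
      have fin: "finite (?D \<times> {1..c})" using p(3) by simp
      have sub: "(\<lambda>m. (k m, f m)) ` B \<subseteq> ?D \<times> {1..c}" using Bm by auto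
      have re: "(\<Sum>m\<in>B. h (k m) (f m)) \<le> (\<Sum>d\<in>?D. \<Sum>i=1..c. h d i)" if h: "\<And>d i. 0 \<le> h d i" for h :: "nat \<Rightarrow> nat \<Rightarrow> real"
      proof -
        have "(\<Sum>m\<in>B. h (k m) (f m)) = (\<Sum>z\<in>(\<lambda>m. (k m, f m)) ` B. case z of (d, i) \<Rightarrow> h d i)"
          by (simp add: sum.reindex[OF inj])
        also have "\<dots> \<le> (\<Sum>z\<in>?D \<times> {1..c}. case z of (d, i) \<Rightarrow> h d i)"
          by (intro sum_mono2 fin sub) (auto simp: h)
        finally show ?thesis by (simp add: sum.cartesian_product)
      qed
      have nn: "0 \<le> ?x ^ i * ?x ^ j * distortion_weight y l" for i j l
        by (intro mult_nonneg_nonneg distortion_weight_nonneg) auto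
      have "(\<Sum>m\<in>B. \<Sum>n\<in>B. ?x ^ f m * ?x ^ f n * distortion_weight y (lcm (k m) (k n)))
        \<le> (\<Sum>m\<in>B. \<Sum>e\<in>?D. \<Sum>j=1..c. ?x ^ f m * ?x ^ j * distortion_weight y (lcm (k m) e))"
        by (intro sum_mono re nn)
      also have "\<dots> \<le> (\<Sum>d\<in>?D. \<Sum>i=1..c. \<Sum>e\<in>?D. \<Sum>j=1..c. ?x ^ i * ?x ^ j * distortion_weight y (lcm d e))"
        by (rule re) (intro sum_nonneg nn)
      also have "\<dots> = (\<Sum>d\<in>?D. \<Sum>e\<in>?D. \<Sum>i=1..c. \<Sum>j=1..c. ?x ^ i * ?x ^ j * distortion_weight y (lcm d e))"
        by (intro sum.cong refl sum.swap)
      also have "\<dots> = (\<Sum>i=1..c. \<Sum>j=1..c. ?x ^ i * ?x ^ j) * divisor_pair_sum y Q"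
        unfolding divisor_pair_sum_def sum_distrib_left[symmetric] sum_distrib_right[symmetric] ..
      also have "(\<Sum>i=1..c. \<Sum>j=1..c. ?x ^ i * ?x ^ j) = (\<Sum>i=1..c. ?x ^ i)\<^sup>2"
        by (simp add: power2_eq_square sum_product)
      also have "(\<Sum>i=1..c. ?x ^ i)\<^sup>2 * divisor_pair_sum y Q \<le> (1 / (real p - 1))\<^sup>2 * divisor_pair_sum y Q"
      proof (intro mult_right_mono power_mono)
        have "(\<Sum>i=1..c. ?x ^ i) \<le> ?x ^ 1 * (1 / (1 - ?x))"
          by (rule geometric_sum_finite_le) (use x1 in auto)
        also have "\<dots> = 1 / (real p - 1)" using x1 by (simp add: field_simps)
        finally show "(\<Sum>i=1..c. ?x ^ i) \<le> 1 / (real p - 1)" .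
        show "0 \<le> (\<Sum>i=1..c. ?x ^ i)" by (intro sum_nonneg) auto
        show "0 \<le> divisor_pair_sum y Q" unfolding divisor_pair_sum_def by (intro sum_nonneg distortion_weight_nonneg)
      qed
      finally show ?thesis .
    qed
    finally show ?thesis .
  qed
  have mass: "avg (Q * P) w' \<ge> avg Q w - 4 / (real p - 1)\<^sup>2 * divisor_pair_sum y Q"
  proof -
    have "avg Q w - 4 * avg Q (\<lambda>x. w x * (al x)\<^sup>2) = avg Q (\<lambda>x. w x - 4 * (w x * (al x)\<^sup>2))"
      unfolding avg_diff avg_cmult ..
    also have "\<dots> \<le> avg Q (\<lambda>x. avg P (\<lambda>y. w' (x + int Q * y)))"
    proof (rule avg_mono)
      fix x
      have "1 - 4 * (al x)\<^sup>2 \<le> of_bool (al x < 1 / 2)"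
      proof (cases "al x < 1 / 2")
        case False
        then have "(1 / 2)\<^sup>2 \<le> (al x)\<^sup>2" by (intro power_mono) auto
        then show ?thesis using False by (simp add: power2_eq_square)
      qed simp
      then have "w x * (1 - 4 * (al x)\<^sup>2) \<le> w x * of_bool (al x < 1 / 2)" using w(2) by (intro mult_left_mono) auto
      then show "w x - 4 * (w x * (al x)\<^sup>2) \<le> avg P (\<lambda>y. w' (x + int Q * y))"
        unfolding fibre by (simp add: algebra_simps)
    qed
    also have "\<dots> = avg (Q * P) w'" by (rule avg_mult[symmetric])
    finally show ?thesis using second by (simp add: power_divide)
  qed
  show ?thesis
    by (intro exI[of _ w']) (use w'_per w'0 pos mass class_le in \<open>auto simp: P_def\<close>)
qed

section \<open>Iteration over all primes\<close>

lemma smooth_on_dvd_part_on: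
  assumes "smooth_on S m" "m dvd N" "N > 0"
  shows "m dvd part_on S N"
proof -
  have "coprime m (part_on (- S) N)"
    by (rule coprime_smooth_on[OF assms(1) smooth_on_part_on]) simp
  then show ?thesis
    using assms(2) part_on_decomp[OF assms(3), of S] by (metis coprime_dvd_mult_left_iff)
qed

lemma smooth_on_primes_upto_Suc:
  assumes "smooth_on (primes_upto (Suc n)) m" "\<not> (prime (Suc n) \<and> Suc n dvd m)"
  shows "smooth_on (primes_upto n) m"
  unfolding smooth_on_def
proof
  show "m > 0" using assms(1) by (simp add: smooth_on_def)
  show "prime_factors m \<subseteq> primes_upto n"
  proof
    fix p assume p: "p \<in> prime_factors m"
    then have "p \<in> primes_upto (Suc n)" "p \<noteq> Suc n" using assms by (auto simp: smooth_on_def in_prime_factors_iff)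
    then show "p \<in> primes_upto n" by (auto simp: primes_upto_def)
  qed
qed

text \<open>Bounds the mass lost at \<open>p\<close>: four times the second moment, with the divisor
  pairs of the part of \<open>N\<close> below \<open>p\<close> replaced by their bounding Euler
  product, hence independent of \<open>N\<close>.\<close>

definition distortion_loss :: "nat \<Rightarrow> nat \<Rightarrow> real" where
  "distortion_loss y p = 4 / (real p - 1)\<^sup>2 * (\<Prod>q\<in>primes_upto (p - 1). pair_factor y q)"

lemma distortion_loss_nonneg: "0 \<le> distortion_loss y p"
  unfolding distortion_loss_def
  by (intro mult_nonneg_nonneg prod_nonneg) (auto simp: primes_upto_def intro: order_trans[OF zero_le_one pair_factor_ge_1])

text \<open>The first weight is the indicator of the set left by the moduli with primes up to
  \<open>y\<close>, undistorted, so that a class modulo \<open>m\<close> has mass at most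
  \<open>1 / m\<close>. Each prime beyond \<open>y\<close> that divides \<open>N\<close> is one
  \<open>distortion_step\<close>; positive mass at the end certifies an uncovered point.\<close>

lemma distortion_method:
  assumes M: "finite M" "\<And>m. m \<in> M \<Longrightarrow> m dvd N" "N > 0" and "y \<le> n"
  shows "\<exists>w. periodic (part_on {..n} N) w \<and> (\<forall>x. 0 \<le> w x)
    \<and> (\<forall>x. w x > 0 \<longrightarrow> uncovered (smooth_part (primes_upto n) M) a x)
    \<and> avg N (\<lambda>x. of_bool (uncovered (smooth_part (primes_upto y) M) a x))
        - (\<Sum>p\<in>primes_upto n - primes_upto y. distortion_loss y p) \<le> avg (part_on {..n} N) w
    \<and> (\<forall>m b. m dvd part_on {..n} N \<longrightarrow>
        avg (part_on {..n} N) (\<lambda>x. w x * of_bool ([x = b] (mod int m))) \<le> distortion_weight y m)"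
  using \<open>y \<le> n\<close>
proof (induction n rule: dec_induct)
  case base
  let ?Q = "part_on {..y} N"
  define w where "w = (\<lambda>x. of_bool (uncovered (smooth_part (primes_upto y) M) a x) :: real)"
  have QN: "?Q dvd N" using part_on_decomp[OF M(3), of "{..y}"] by (metis dvd_triv_left)
  have per: "periodic ?Q w" unfolding w_def
  proof (rule periodic_comp[OF periodic_uncovered])
    fix m assume "m \<in> smooth_part (primes_upto y) M"
    then have "m \<in> M" "smooth_on {..y} m" by (auto simp: smooth_part_def primes_upto_def intro: smooth_on_mono)
    then show "m dvd ?Q" using M by (intro smooth_on_dvd_part_on) auto
  qed
  have "avg ?Q (\<lambda>x. w x * of_bool ([x = b] (mod int m))) \<le> distortion_weight y m" if "m dvd ?Q" for m b
  proof -
    have "avg ?Q (\<lambda>x. w x * of_bool ([x = b] (mod int m))) \<le> avg ?Q (\<lambda>x. of_bool ([x = b] (mod int m)))"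
      by (rule avg_mono) (simp add: w_def)
    also have "\<dots> = 1 / real m" by (rule avg_class[OF that part_on_pos])
    also have "\<dots> \<le> distortion_weight y m" by (rule distortion_weight_ge)
    finally show ?thesis .
  qed
  moreover have "avg N w = avg ?Q w" by (rule avg_dvd[OF per QN M(3)])
  ultimately show ?case using per by (intro exI[of _ w]) (auto simp: w_def)
next
  case (step n)
  let ?Q = "part_on {..n} N" and ?p = "Suc n"
  let ?loss = "\<lambda>n. \<Sum>p\<in>primes_upto n - primes_upto y. distortion_loss y p"
  define c where "c = count (prime_factorization N) ?p"
  have Q: "part_on {..Suc n} N = ?Q * ?p ^ c" unfolding c_def by (rule part_on_atMost_Suc[OF M(3)])
  obtain w where w: "periodic ?Q w" "\<And>x. 0 \<le> w x"
      "\<And>x. w x > 0 \<Longrightarrow> uncovered (smooth_part (primes_upto n) M) a x"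
      "avg N (\<lambda>x. of_bool (uncovered (smooth_part (primes_upto y) M) a x)) - ?loss n \<le> avg ?Q w"
      "\<And>m b. m dvd ?Q \<Longrightarrow> avg ?Q (\<lambda>x. w x * of_bool ([x = b] (mod int m))) \<le> distortion_weight y m"
    using step.IH by blast
  show ?case
  \<comment> \<open>\<open>c = 0\<close> covers both composite \<open>n + 1\<close> and primes that
    do not divide \<open>N\<close>; no further modulus of \<open>M\<close> becomes smooth
    then.\<close>
  proof (cases "c = 0")
    case True
    have "smooth_part (primes_upto (Suc n)) M \<subseteq> smooth_part (primes_upto n) M"
    proof
      fix m assume m: "m \<in> smooth_part (primes_upto (Suc n)) M"
      have "\<not> (prime ?p \<and> ?p dvd m)"
      proof
        assume "prime ?p \<and> ?p dvd m"
        then have "?p \<in> prime_factors N"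
          using m M by (auto simp: smooth_part_def in_prime_factors_iff intro: dvd_trans)
        then show False using True by (simp add: c_def count_eq_zero_iff)
      qed
      then show "m \<in> smooth_part (primes_upto n) M"
        using m smooth_on_primes_upto_Suc by (auto simp: smooth_part_def)
    qed
    then have cov: "uncovered (smooth_part (primes_upto n) M) a x \<Longrightarrow> uncovered (smooth_part (primes_upto (Suc n)) M) a x" for x
      by (auto simp: uncovered_def)
    have "?loss n \<le> ?loss (Suc n)"
      by (intro sum_mono2 distortion_loss_nonneg) (auto simp: primes_upto_def)
    then have "avg N (\<lambda>x. of_bool (uncovered (smooth_part (primes_upto y) M) a x)) - ?loss (Suc n) \<le> avg ?Q w"
      using w(4) by linarith
    then show ?thesis using w cov Q True by (intro exI[of _ w]) auto
  next
    case False
    then have p: "prime ?p" unfolding c_def by (meson count_prime_factorization_nonprime)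
    have ins: "primes_upto (Suc n) - primes_upto y = insert ?p (primes_upto n - primes_upto y)"
      using p step.hyps by (auto simp: primes_upto_def le_Suc_eq)
    have new: "?p \<notin> primes_upto n - primes_upto y" by (simp add: primes_upto_def)
    define B where "B = {m \<in> M. smooth_on (primes_upto (Suc n)) m \<and> ?p dvd m}"
    have c1: "1 \<le> c" and yp: "y < ?p" using False step.hyps by auto
    have B: "finite B" "m \<in> B \<Longrightarrow> ?p dvd m \<and> m dvd ?Q * ?p ^ c" for m
    proof -
      show "finite B" using M(1) by (simp add: B_def)
      assume "m \<in> B"
      then have "m \<in> M" "smooth_on {..Suc n} m" "?p dvd m"
        by (auto simp: B_def primes_upto_def intro: smooth_on_mono)
      then show "?p dvd m \<and> m dvd ?Q * ?p ^ c"
        using smooth_on_dvd_part_on[of "{..Suc n}" m N] M Q by auto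
    qed
    obtain w' where w': "periodic (?Q * ?p ^ c) w'" "\<And>x. 0 \<le> w' x"
      "\<And>x. w' x > 0 \<Longrightarrow> w x > 0 \<and> uncovered B a x"
      "avg (?Q * ?p ^ c) w' \<ge> avg ?Q w - 4 / (real ?p - 1)\<^sup>2 * divisor_pair_sum y ?Q"
      "\<And>m b. m dvd ?Q * ?p ^ c \<Longrightarrow> avg (?Q * ?p ^ c) (\<lambda>x. w' x * of_bool ([x = b] (mod int m))) \<le> distortion_weight y m"
      using distortion_step[where a=a, OF p coprime_part_on_atMost[OF p] part_on_pos c1 yp B w(1,2,5)] by blast
    have cov: "uncovered (smooth_part (primes_upto (Suc n)) M) a x" if "w' x > 0" for x
    proof -
      have "uncovered (smooth_part (primes_upto n) M) a x" "uncovered B a x" using w'(3)[OF that] w(3) by auto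
      then show ?thesis using smooth_on_primes_upto_Suc by (auto simp: uncovered_def smooth_part_def B_def)
    qed
    have "4 / (real ?p - 1)\<^sup>2 * divisor_pair_sum y ?Q \<le> distortion_loss y ?p"
      unfolding distortion_loss_def using divisor_pair_sum_le[OF M(3), of y n]
      by (intro mult_left_mono) auto
    moreover have "?loss (Suc n) = distortion_loss y ?p + ?loss n" unfolding ins using new by simp
    ultimately have "avg N (\<lambda>x. of_bool (uncovered (smooth_part (primes_upto y) M) a x)) - ?loss (Suc n) \<le> avg (?Q * ?p ^ c) w'"
      using w(4) w'(4) by linarith
    then show ?thesis unfolding Q using w' cov by (intro exI[of _ w']) auto
  qed
qed

text \<open>The block above \<open>2 ^ L\<close> has at most \<open>2 ^ L\<close> primes, each
  losing at most \<open>4 * 486 * (L + 1) ^ 24 / 4 ^ L\<close>, so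
  \<open>1944 * (L + 1) ^ 24 / 2 ^ L\<close> in all. The bound telescopes:
  \<open>7776 = 4 * 1944\<close>, and \<open>(L + 1) ^ 24 / 2 ^ L\<close> shrinks at least by the
  factor \<open>3 / 4\<close> from one \<open>L\<close> to the next, as \<open>L \<ge> 100\<close>
  makes \<open>((L + 2) / (L + 1)) ^ 24 \<le> 3 / 2\<close>.\<close>

lemma distortion_loss_sum_le:
  assumes "100 \<le> K" "K \<le> L"
  shows "(\<Sum>p\<in>primes_upto (2 ^ L) - primes_upto (2 ^ K). distortion_loss (2 ^ K) p)
    \<le> 7776 * real (K + 1) ^ 24 / 2 ^ K - 7776 * real (L + 1) ^ 24 / 2 ^ L"
  using assms(2)
proof (induction L rule: dec_induct)
  case (step L)
  define B where "B = {p. prime p \<and> 2 ^ L < p \<and> p \<le> (2::nat) ^ (L + 1)}"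
  have fin: "finite B" unfolding B_def by (rule finite_subset[of _ "{..2^(L+1)}"]) auto
  have KL: "(2::nat) ^ K \<le> 2 ^ L" using step.hyps by (intro power_increasing) auto
  have eq: "primes_upto (2 ^ Suc L) - primes_upto (2 ^ K) = (primes_upto (2 ^ L) - primes_upto (2 ^ K)) \<union> B"
  proof -
    have "p \<notin> primes_upto (2 ^ K)" if "p \<in> B" for p
    proof -
      have "2 ^ K < p" using order_le_less_trans[OF KL] that by (auto simp: B_def)
      then show ?thesis by (simp add: primes_upto_def)
    qed
    then show ?thesis unfolding Suc_eq_plus1 primes_upto_pow_Suc B_def[symmetric] by blast
  qed
  have disj: "(primes_upto (2 ^ L) - primes_upto (2 ^ K)) \<inter> B = {}" by (auto simp: primes_upto_def B_def)
  have "card B \<le> card {2 ^ L <.. (2::nat) ^ (L + 1)}" unfolding B_def by (intro card_mono) auto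
  then have cardB: "real (card B) \<le> 2 ^ L" by simp
  have "(\<Sum>p\<in>B. distortion_loss (2 ^ K) p) \<le> (\<Sum>p\<in>B. 4 / (2 ^ L)\<^sup>2 * (486 * real (L + 1) ^ 24))"
  proof (rule sum_mono)
    fix p assume p: "p \<in> B"
    have "(\<Prod>q\<in>primes_upto (p - 1). pair_factor (2 ^ K) q) \<le> (\<Prod>q\<in>primes_upto (2 ^ (L + 1)). pair_factor (2 ^ K) q)"
    proof (rule prod_mono2)
      show "primes_upto (p - 1) \<subseteq> primes_upto (2 ^ (L + 1))" using p by (auto simp: primes_upto_def B_def)
    qed (auto simp: primes_upto_def pair_factor_ge_1 intro: order_trans[OF zero_le_one pair_factor_ge_1])
    also have "\<dots> \<le> 486 * real (L + 1) ^ 24"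
      by (rule prod_pair_factor_le) (use assms(1) step.hyps power_increasing[of 1 K "2::nat"] in auto)
    finally have 1: "(\<Prod>q\<in>primes_upto (p - 1). pair_factor (2 ^ K) q) \<le> 486 * real (L + 1) ^ 24" .
    have "2 ^ L + 1 \<le> p" using p by (auto simp: B_def)
    then have "real (2 ^ L + 1) \<le> real p" by (rule of_nat_mono)
    then have "2 ^ L \<le> real p - 1" by simp
    then have 2: "4 / (real p - 1)\<^sup>2 \<le> 4 / (2 ^ L)\<^sup>2" by (intro frac_le power_mono) auto
    show "distortion_loss (2 ^ K) p \<le> 4 / (2 ^ L)\<^sup>2 * (486 * real (L + 1) ^ 24)"
      unfolding distortion_loss_def
      by (rule mult_mono[OF 2 1])
        (auto simp: primes_upto_def intro!: prod_nonneg intro: order_trans[OF zero_le_one pair_factor_ge_1])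
  qed
  also have "\<dots> = real (card B) * (4 / (2 ^ L)\<^sup>2 * (486 * real (L + 1) ^ 24))" by simp
  also have "\<dots> \<le> 2 ^ L * (4 / (2 ^ L)\<^sup>2 * (486 * real (L + 1) ^ 24))"
    using cardB by (intro mult_right_mono) auto
  also have "\<dots> = 1944 * real (L + 1) ^ 24 / 2 ^ L" by (simp add: power2_eq_square)
  also have "\<dots> \<le> 7776 * real (L + 1) ^ 24 / 2 ^ L - 7776 * real (Suc L + 1) ^ 24 / 2 ^ Suc L"
  proof -
    define s where "s = real (L + 1)"
    have s: "s \<ge> 101" using assms(1) step.hyps by (simp add: s_def)
    have "(1 + 1 / s) ^ 24 \<le> exp (1 / s) ^ 24" using s by (intro power_mono exp_ge_add_one_self) auto
    also have "\<dots> = exp (24 / s)" by (simp flip: exp_of_nat_mult)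
    also have "\<dots> \<le> 3 / 2"
    proof -
      have "1 - 24 / s \<le> exp (- (24 / s))" using exp_ge_add_one_self[of "- (24 / s)"] by simp
      moreover have "2 / 3 \<le> 1 - 24 / s" using s by (simp add: field_simps)
      ultimately have "2 / 3 \<le> inverse (exp (24 / s))" by (simp add: exp_minus)
      then show ?thesis by (simp add: field_simps)
    qed
    finally have "s ^ 24 * (1 + 1 / s) ^ 24 \<le> s ^ 24 * (3 / 2)" using s by (intro mult_left_mono) auto
    moreover have "s ^ 24 * (1 + 1 / s) ^ 24 = (s + 1) ^ 24" using s by (simp add: power_mult_distrib[symmetric] field_simps)
    ultimately have "(s + 1) ^ 24 \<le> s ^ 24 * (3 / 2)" by simp
    moreover have "real (Suc L + 1) = s + 1" by (simp add: s_def)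
    ultimately show ?thesis unfolding s_def[symmetric] by (simp add: field_simps)
  qed
  finally show ?case unfolding eq sum.union_disjoint[OF finite_Diff[OF finite_primes_upto] fin disj]
    using step.IH by linarith
qed simp

lemma exists_uncovered:
  assumes M: "finite M" "\<And>m. m \<in> M \<Longrightarrow> m dvd N" "N > 0" and K: "100 \<le> K"
    and big: "7776 * real (K + 1) ^ 24 / 2 ^ K < avg N (\<lambda>x. of_bool (uncovered (smooth_part (primes_upto (2 ^ K)) M) a x))"
  shows "\<exists>x. uncovered M a x"
proof -
  \<comment> \<open>Every modulus divides \<open>N < 2 ^ N\<close>, so all of them are
    \<open>2 ^ L\<close>-smooth.\<close>
  define L where "L = max K N"
  have L: "K \<le> L" "N \<le> L" by (auto simp: L_def)
  have NL: "N \<le> 2 ^ L"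
    using less_exp[of N] power_increasing[OF L(2), of "2::nat"] by linarith
  have KL: "(2::nat) ^ K \<le> 2 ^ L" using L by (intro power_increasing) auto
  obtain w where w: "\<And>x. w x > 0 \<Longrightarrow> uncovered (smooth_part (primes_upto (2 ^ L)) M) a x"
      "avg N (\<lambda>x. of_bool (uncovered (smooth_part (primes_upto (2 ^ K)) M) a x))
        - (\<Sum>p\<in>primes_upto (2 ^ L) - primes_upto (2 ^ K). distortion_loss (2 ^ K) p) \<le> avg (part_on {..2 ^ L} N) w"
    using distortion_method[OF M KL, of a] by blast
  have "(\<Sum>p\<in>primes_upto (2 ^ L) - primes_upto (2 ^ K). distortion_loss (2 ^ K) p) \<le> 7776 * real (K + 1) ^ 24 / 2 ^ K - 7776 * real (L + 1) ^ 24 / 2 ^ L"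
    by (rule distortion_loss_sum_le[OF K L(1)])
  moreover have "0 \<le> 7776 * real (L + 1) ^ 24 / 2 ^ L" by simp
  ultimately have "0 < avg (part_on {..2 ^ L} N) w" using big w(2) by linarith
  then obtain x where "w x > 0" using avg_pos_witness by blast
  moreover have "smooth_part (primes_upto (2 ^ L)) M = M"
  proof -
    have "smooth_on (primes_upto (2 ^ L)) m" if "m \<in> M" for m
    proof -
      have m: "m > 0" "m \<le> N" using M(2)[OF that] M(3) by (auto intro: Nat.gr0I dvd_imp_le)
      have "p \<le> 2 ^ L" if "p \<in> prime_factors m" for p
      proof -
        have "p \<le> m" using that m(1) by (auto intro: dvd_imp_le)
        then show ?thesis using m(2) NL by linarith
      qed
      then show ?thesis using m(1) by (auto simp: smooth_on_def primes_upto_def)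
    qed
    then show ?thesis by (auto simp: smooth_part_def)
  qed
  ultimately show ?thesis using w(1) by auto
qed

section \<open>The lower bound for the reciprocal sum\<close>

text \<open>The final estimate needs \<open>2 * 4 * 10 ^ 20 * ln 2 \<le> 5.846 * 10 ^ 20\<close>,
  which leaves room up to \<open>0.73075\<close>.\<close>

lemma ln_2_le_73: "ln (2::real) \<le> 73 / 100"
proof -
  have "1 + (73/200) + (73/200)\<^sup>2 / 2 \<le> exp (73/200 :: real)" by (rule exp_lower_Taylor_quadratic) simp
  then have "(1 + (73/200) + (73/200)\<^sup>2 / 2)\<^sup>2 \<le> (exp (73/200 :: real))\<^sup>2" by (intro power_mono) auto
  also have "\<dots> = exp (73/100)" by (simp add: power2_eq_square flip: exp_add)
  finally have "2 \<le> exp (73/100 :: real)" by (simp add: power2_eq_square)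
  then have "ln 2 \<le> ln (exp (73/100 :: real))" by (subst ln_le_cancel_iff) auto
  then show ?thesis by simp
qed

lemma ln_2_ge_4_7: "4 / 7 \<le> ln (2::real)"
proof -
  have "exp (4 / 7 :: real) ^ 7 = exp 1 ^ 4" by (simp flip: exp_of_nat_mult)
  also have "\<dots> \<le> 3 ^ 4" using exp_le by (intro power_mono) auto
  also have "\<dots> \<le> 2 ^ 7" by simp
  finally have "exp (4 / 7 :: real) \<le> 2" by (rule power_le_imp_le_base[of _ 6, simplified]) auto
  then have "ln (exp (4 / 7)) \<le> ln (2 :: real)" by (subst ln_le_cancel_iff) auto
  then show ?thesis by simp
qed

text \<open>The tight case is \<open>t = 36\<close>, about \<open>6.12 * 10 ^ 10\<close> against
  \<open>6.87 * 10 ^ 10\<close>, while \<open>t = 35\<close> fails; this is what asks for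
  \<open>K \<ge> 2 ^ 36\<close>. From there on the fourth power grows at most by
  \<open>1.1 ^ 4 < 2\<close> per step.\<close>

lemma quartic_le_power:
  assumes "36 \<le> t"
  shows "49 * (5 * t + 8) ^ 4 \<le> (2::nat) ^ t"
  using assms
proof (induction t rule: dec_induct)
  case (step t)
  have "10 * (5 * Suc t + 8) \<le> 11 * (5 * t + 8)" using step.hyps by simp
  then have "(10 * (5 * Suc t + 8)) ^ 4 \<le> (11 * (5 * t + 8)) ^ 4" by (rule power_mono) simp
  then have "10000 * (5 * Suc t + 8) ^ 4 \<le> 14641 * (5 * t + 8) ^ 4" by (simp only: power_mult_distrib) simp
  then have "(5 * Suc t + 8) ^ 4 \<le> 2 * (5 * t + 8) ^ 4" by linarith
  then show ?case using step.IH by simp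
qed simp

text \<open>The graph of \<open>ln\<close> lies below its tangent at 8. The threshold 188 is
  \<open>5 * 36 + 8\<close>, the least \<open>k\<close> that occurs in
  \<open>reciprocal_sum_ge\<close>.\<close>

lemma log_term_le:
  fixes x :: real
  assumes "188 \<le> x"
  shows "20 * x ^ 3 * (1 / 3 + 2 * ln x) \<le> 7 * x ^ 4"
proof -
  have "ln (x / 8) \<le> x / 8 - 1" using assms by (intro ln_le_minus_one) auto
  moreover have "ln (x / 8) = ln x - ln 8" using assms by (subst ln_div) auto
  moreover have "ln (8::real) = 3 * ln 2" using ln_realpow[of 2 3] by simp
  ultimately have "ln x \<le> x / 8 + 2" using ln_2_le_73 by simp
  then have "1 / 3 + 2 * ln x \<le> 7 / 20 * x" using assms by simp
  then have "20 * x ^ 3 * (1 / 3 + 2 * ln x) \<le> 20 * x ^ 3 * (7 / 20 * x)" using assms by (intro mult_left_mono) auto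
  also have "\<dots> = 7 * x ^ 4" by (simp add: power4_eq_xxxx power3_eq_cube)
  finally show ?thesis .
qed

text \<open>The reciprocal sum is the mean number of classes that contain an integer: at least 1
  everywhere, and at least 2 on a whole class modulo \<open>lcm m n\<close>.\<close>

lemma reciprocal_sum_overlap:
  assumes M: "finite M" "\<And>m. m \<in> M \<Longrightarrow> m > 0" "\<And>x. \<not> uncovered M a x"
    and mn: "m \<in> M" "n \<in> M" "m \<noteq> n" "[x = a m] (mod int m)" "[x = a n] (mod int n)"
  shows "1 + 1 / real (m * n) \<le> (\<Sum>k\<in>M. 1 / real k)"
proof -
  define N where "N = \<Prod>M"
  have N: "N > 0" "k dvd N" if "k \<in> M" for k
    unfolding N_def using M(1,2) that by (auto intro: prod_pos dvd_prodI)
  have N0: "N > 0" using N(1) mn(1) by blast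
  define l where "l = lcm m n"
  have l: "l dvd N" "l > 0" "l \<le> m * n"
    unfolding l_def using N(2) mn M(2) by (auto simp: lcm_pos_nat intro!: lcm_least dvd_imp_le)
  have "real l \<le> real (m * n)" using l(3) by (rule of_nat_mono)
  then have "1 + 1 / real (m * n) \<le> 1 + 1 / real l" using l(2) by (intro add_left_mono frac_le) auto
  also have "\<dots> = avg N (\<lambda>y. 1 + of_bool ([y = x] (mod int l)))"
    unfolding avg_add avg_const[OF N0] avg_class[OF l(1) N0] ..
  also have "\<dots> \<le> avg N (\<lambda>y. \<Sum>k\<in>M. of_bool ([y = a k] (mod int k)))"
  proof (rule avg_mono)
    fix y
    show "1 + of_bool ([y = x] (mod int l)) \<le> (\<Sum>k\<in>M. of_bool ([y = a k] (mod int k)) :: real)"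
    proof (cases "[y = x] (mod int l)")
      case True
      have "[y = x] (mod int m)" "[y = x] (mod int n)"
        using True by (auto simp: l_def intro: cong_dvd_modulus)
      then have "[y = a m] (mod int m)" "[y = a n] (mod int n)" using mn by (blast intro: cong_trans)+
      then have "(\<Sum>k\<in>{m,n}. of_bool ([y = a k] (mod int k)) :: real) = 2" using mn(3) by simp
      moreover have "(\<Sum>k\<in>{m,n}. of_bool ([y = a k] (mod int k)) :: real) \<le> (\<Sum>k\<in>M. of_bool ([y = a k] (mod int k)))"
        by (rule sum_mono2) (use M mn in auto)
      ultimately show ?thesis using True by simp
    next
      case False
      obtain k where k: "k \<in> M" "[y = a k] (mod int k)" using M(3)[of y] by (auto simp: uncovered_def)
      have "of_bool ([y = a k] (mod int k)) \<le> (\<Sum>k\<in>M. of_bool ([y = a k] (mod int k)) :: real)"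
        by (rule member_le_sum) (use M k in auto)
      then show ?thesis using k False by simp
    qed
  qed
  also have "\<dots> = (\<Sum>k\<in>M. 1 / real k)"
    unfolding avg_sum using N N0 by (intro sum.cong avg_class) auto
  finally show ?thesis .
qed

text \<open>Polynomial factors are measured in powers of 2: since
  \<open>K + 1 \<le> 2 ^ (t + 1)\<close>, they are at most \<open>2 ^ (26 * t + 40)\<close>, and
  \<open>K\<close> is so much larger than \<open>t\<close> that this is at most
  \<open>2 ^ (K / 4)\<close>. As \<open>ln 2 \<ge> 4 / 7\<close>, also
  \<open>exp (K / 7) \<le> 2 ^ (K / 4)\<close>, and the product is below
  \<open>2 ^ K\<close>.\<close>

lemma error_terms_small:
  assumes t: "36 \<le> t" and K: "2 ^ t \<le> K" "K < 2 ^ (t + 1)"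
  shows "36 * real K ^ 12 / 2 ^ K + 7776 * real (K + 1) ^ 24 / 2 ^ K
    < 1 / 2 * (1 / real K ^ 2 * exp (- (real K / 7)))"
proof -
  have K1: "real (K + 1) \<le> 2 ^ (t + 1)" using K(2) by (metis Suc_eq_plus1 Suc_leI of_nat_le_iff of_nat_numeral of_nat_power)
  have K0: "real K \<ge> 1" using K(1) by (metis of_nat_1 of_nat_le_iff one_le_numeral one_le_power order_trans)
  have "36 * real K ^ 12 + 7776 * real (K + 1) ^ 24 \<le> 36 * real (K + 1) ^ 24 + 7776 * real (K + 1) ^ 24"
  proof -
    have "real K ^ 12 \<le> real (K + 1) ^ 12" by (intro power_mono) auto
    also have "\<dots> \<le> real (K + 1) ^ 24" by (intro power_increasing) auto
    finally show ?thesis by simp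
  qed
  also have "\<dots> \<le> 2 ^ 13 * real (K + 1) ^ 24" by simp
  finally have "2 * real K ^ 2 * (36 * real K ^ 12 + 7776 * real (K + 1) ^ 24) \<le> 2 * real (K + 1) ^ 2 * (2 ^ 13 * real (K + 1) ^ 24)"
    by (intro mult_mono power_mono) auto
  also have "\<dots> = 2 ^ 14 * real (K + 1) ^ 26" by (simp flip: power_add)
  also have "\<dots> \<le> 2 ^ 14 * (2 ^ (t + 1)) ^ 26" using K1 by (intro mult_left_mono power_mono) auto
  also have "\<dots> = 2 ^ (26 * t + 40)" by (simp add: power_mult[symmetric] power_add algebra_simps)
  also have "\<dots> = exp (real (26 * t + 40) * ln 2)" by (subst exp_of_nat_mult) simp
  finally have A: "2 * real K ^ 2 * (36 * real K ^ 12 + 7776 * real (K + 1) ^ 24) \<le> exp (real (26 * t + 40) * ln 2)" .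
  have "4 * (26 * t + 40) \<le> K"
  proof -
    have "4 * (26 * t + 40) \<le> 21 * (5 * t + 8)" by simp
    also have "\<dots> \<le> 49 * (5 * t + 8) ^ 4"
    proof -
      have "5 * t + 8 \<le> (5 * t + 8) ^ 4" by (rule self_le_power) auto
      then show ?thesis by (intro mult_mono) auto
    qed
    also have "\<dots> \<le> K" using quartic_le_power[OF t] K(1) by linarith
    finally show ?thesis .
  qed
  then have "4 * real (26 * t + 40) \<le> real K" by (metis of_nat_le_iff of_nat_mult of_nat_numeral)
  then have "real (26 * t + 40) * ln 2 \<le> real K / 4 * ln 2" by (intro mult_right_mono) auto
  moreover have "real K / 7 \<le> real K / 4 * ln 2"
  proof -
    have "real K / 4 * (4 / 7) \<le> real K / 4 * ln 2" using ln_2_ge_4_7 by (intro mult_left_mono) auto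
    then show ?thesis by simp
  qed
  moreover have "0 < real K * ln 2" using K0 by simp
  ultimately have B: "real (26 * t + 40) * ln 2 + real K / 7 < real K * ln 2" by (simp add: field_simps)
  have "2 * real K ^ 2 * (36 * real K ^ 12 + 7776 * real (K + 1) ^ 24) * exp (real K / 7)
      \<le> exp (real (26 * t + 40) * ln 2) * exp (real K / 7)"
    using A by (intro mult_right_mono) auto
  also have "\<dots> < exp (real K * ln 2)" using B by (simp flip: exp_add)
  also have "\<dots> = 2 ^ K" by (simp add: exp_of_nat_mult)
  finally have C: "2 * real K ^ 2 * (36 * real K ^ 12 + 7776 * real (K + 1) ^ 24) * exp (real K / 7) < 2 ^ K" .
  define X where "X = 36 * real K ^ 12 + 7776 * real (K + 1) ^ 24"
  define Y where "Y = 2 * real K ^ 2 * exp (real K / 7)"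
  have "Y > 0" using K0 by (simp add: Y_def)
  have "X * Y = 2 * real K ^ 2 * X * exp (real K / 7)" by (simp only: Y_def mult_ac)
  then have "X * Y < 2 ^ K" using C unfolding X_def by (simp only:)
  then have "X / 2 ^ K < 1 / Y" using \<open>Y > 0\<close> by (simp add: pos_divide_less_eq pos_less_divide_eq)
  also have "1 / Y = 1 / 2 * (1 / real K ^ 2 * exp (- (real K / 7)))"
    unfolding Y_def exp_minus by (simp add: inverse_eq_divide)
  finally show ?thesis unfolding X_def by (simp only: add_divide_distrib)
qed

lemma reciprocal_sum_ge:
  assumes M: "finite M" "\<And>m. m \<in> M \<Longrightarrow> m > 0" "\<And>x. \<not> uncovered M a x"
    and N: "\<And>m. m \<in> M \<Longrightarrow> m dvd N" "N > 0"
    and t: "36 \<le> t" and K: "2 ^ t \<le> K" "K < 2 ^ (t + 1)"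
    and dens: "1 / real K ^ 2 \<le> avg N (\<lambda>x. of_bool (uncovered (smooth_part (primes_upto 4) M) a x))"
  shows "1 + 1 / 2 ^ (2 * (K * K)) \<le> (\<Sum>m\<in>M. 1 / real m)"
proof (rule ccontr)
  assume less: "\<not> 1 + 1 / 2 ^ (2 * (K * K)) \<le> (\<Sum>m\<in>M. 1 / real m)"
  define S where "S = {m \<in> M. m \<le> 2 ^ (K * K)}"
  have S: "finite S" "\<And>m. m \<in> S \<Longrightarrow> m dvd N" using M(1) N by (auto simp: S_def)
  have disj: "disjoint_classes S a"
    unfolding disjoint_classes_def
  proof (intro ballI allI impI, rule ccontr)
    fix m n x assume mn: "m \<in> S" "n \<in> S" "[x = a m] (mod int m)" "[x = a n] (mod int n)" "m \<noteq> n"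
    have "m * n \<le> 2 ^ (K * K) * 2 ^ (K * K)" using mn by (intro mult_mono) (auto simp: S_def)
    also have "\<dots> = 2 ^ (2 * (K * K))" by (simp add: mult_2 power_add)
    finally have "real (m * n) \<le> 2 ^ (2 * (K * K))" by (metis of_nat_le_iff of_nat_numeral of_nat_power)
    moreover have "0 < real (m * n)" using mn M(2) by (auto simp: S_def)
    ultimately have "1 / 2 ^ (2 * (K * K)) \<le> 1 / real (m * n)" by (intro frac_le) auto
    then show False
      using less reciprocal_sum_overlap[OF M, of m n x] mn by (auto simp: S_def)
  qed
  define A where "A = (\<lambda>n M. avg N (\<lambda>x. of_bool (uncovered (smooth_part (primes_upto n) M) a x)))"
  have A0: "0 \<le> A n S" for n S unfolding A_def by (rule avg_nonneg) simp
  \<comment> \<open>\<open>2 ^ k = 8 * (2 ^ (t + 1)) ^ 5\<close> exceeds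
    \<open>8 * K ^ 5 = 2 * K ^ 2 * (4 * K ^ 3)\<close>, which \<open>uncovered_medium_primes\<close>
    with \<open>J = K * K\<close> requires of its lower cutoff.\<close>
  define k where "k = 5 * t + 8"
  have k: "2 \<le> k" "188 \<le> k" using t by (auto simp: k_def)
  have tK: "49 * k ^ 4 \<le> K" using quartic_le_power[OF t] K(1) unfolding k_def by linarith
  have "k \<le> k ^ 4" by (rule self_le_power) (use k in auto)
  then have kK: "k \<le> K" using tK by linarith
  have "1 / real K ^ 2 \<le> A 4 M" using dens by (simp add: A_def)
  also have "\<dots> \<le> A 4 S" unfolding A_def
    by (rule avg_mono) (auto simp: uncovered_def smooth_part_def S_def)
  finally have A4: "1 / real K ^ 2 \<le> A 4 S" .
  have Az: "A 4 S * exp (- 20 * real k ^ 3 * (1 / 3 + 2 * ln (real k))) \<le> A (2 ^ k) S"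
    unfolding A_def by (rule uncovered_primes_upto_power[OF disj S N(2) k(1)])
  have Ay: "1 / 2 * A (2 ^ k) S \<le> A (2 ^ K) S"
    unfolding A_def
  proof (rule uncovered_medium_primes[OF disj S N(2), where J="K * K"])
    show "(2::nat) ^ k \<le> 2 ^ K" using kK by (intro power_increasing) auto
    have "2 * real (K * K) * euler_prod (primes_upto (2 ^ K)) \<le> 2 * real (K * K) * (4 * real K ^ 3)"
      using k kK by (intro mult_left_mono euler_prod_primes_upto_le) auto
    also have "\<dots> = 8 * real K ^ 5" by (simp add: eval_nat_numeral)
    also have "\<dots> \<le> 8 * (2 ^ (t + 1)) ^ 5"
    proof -
      have "real K \<le> 2 ^ (t + 1)" using K(2) by (metis less_imp_le of_nat_le_iff of_nat_numeral of_nat_power)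
      then show ?thesis by (intro mult_left_mono power_mono) auto
    qed
    also have "\<dots> = 2 ^ k" unfolding k_def
      by (simp add: power_mult[symmetric] power_add algebra_simps)
    finally show "2 * real (K * K) * euler_prod (primes_upto (2 ^ K)) \<le> real (2 ^ k)" by simp
  qed (auto simp: S_def)
  \<comment> \<open>\<open>log_term_le\<close> bounds the left-hand side by
    \<open>7 * k ^ 4\<close>; to stay below \<open>K / 7\<close> this needs the 49 in
    \<open>quartic_le_power\<close>.\<close>
  have "20 * real k ^ 3 * (1 / 3 + 2 * ln (real k)) \<le> real K / 7"
  proof -
    have "real (49 * k ^ 4) \<le> real K" using tK by (rule of_nat_mono)
    then show ?thesis using log_term_le[of "real k"] k(2) by simp
  qed
  then have "1 / real K ^ 2 * exp (- (real K / 7)) \<le> A 4 S * exp (- 20 * real k ^ 3 * (1 / 3 + 2 * ln (real k)))"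
    using A4 A0 by (intro mult_mono) auto
  then have main: "1 / 2 * (1 / real K ^ 2 * exp (- (real K / 7))) \<le> A (2 ^ K) S" using Az Ay by linarith
  \<comment> \<open>The smooth moduli above \<open>2 ^ (K * K)\<close> may overlap with others; a
    plain union bound suffices for them.\<close>
  define T where "T = {m \<in> M. smooth_on (primes_upto (2 ^ K)) m \<and> m > 2 ^ (K * K)}"
  have "A (2 ^ K) S - (\<Sum>m\<in>T. 1 / real m) \<le> A (2 ^ K) M"
    unfolding A_def
    by (rule avg_uncovered_diff_le) (use M(1) N in \<open>auto simp: T_def S_def smooth_part_def\<close>)
  moreover have "(\<Sum>m\<in>T. 1 / real m) \<le> 36 * real K ^ 12 / 2 ^ K"
    by (rule smooth_tail_sum_le) (use k kK M(1) in \<open>auto simp: T_def\<close>)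
  moreover note error_terms_small[OF t K] main
  ultimately have "7776 * real (K + 1) ^ 24 / 2 ^ K < A (2 ^ K) M" by linarith
  then have "\<exists>x. uncovered M a x"
    using k kK by (intro exists_uncovered[OF M(1) N]) (auto simp: A_def)
  then show False using M(3) by blast
qed

section \<open>Application to covering systems\<close>

lemma three_smooth_iff: "three_smooth m \<longleftrightarrow> smooth_on (primes_upto 4) m"
  unfolding three_smooth_def smooth_on_def primes_upto_4 by (auto simp: in_prime_factors_iff)

theorem theorem2:
  fixes C :: "congruence set" and \<Delta> :: real
  assumes "finite C"
    and "covering_system C"
    and "distinct_moduli C"
    and "\<Delta> = uncovered_density C"
    and "\<Delta> \<in> {0<..<1/12}"
  shows "(\<Sum>(a, m)\<in>C. 1 / real m)
           \<ge> 1 + exp (- (5.846 * 10 ^ 20 - 1.242 * 10 ^ 19 * ln \<Delta>) / \<Delta>)"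
proof -
  define M where "M = snd ` C"
  define a where "a = (\<lambda>m. fst (inv_into C snd m))"
  have inj: "inj_on snd C" using assms(3) by (simp add: distinct_moduli_def)
  have a: "satisfies x c \<longleftrightarrow> [x = a (snd c)] (mod int (snd c))" if "c \<in> C" for x c
    using inv_into_f_f[OF inj that] by (simp add: satisfies_def a_def)
  have M: "finite M" "\<And>m. m \<in> M \<Longrightarrow> m > 0"
    using assms(1,2) by (auto simp: M_def covering_system_def)
  have cov: "\<not> uncovered M a x" for x
    using assms(2) a by (fastforce simp: covering_system_def uncovered_def M_def)
  define N where "N = \<Prod>M"
  have N: "N > 0" "\<And>m. m \<in> M \<Longrightarrow> m dvd N"
    unfolding N_def using M by (auto intro: prod_pos dvd_prodI)
  have unc: "\<not> (\<exists>c\<in>three_smooth_part C. satisfies n c) \<longleftrightarrow> uncovered (smooth_part (primes_upto 4) M) a n" for n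
    using a by (auto simp: three_smooth_part_def uncovered_def smooth_part_def M_def three_smooth_iff)
  have per: "periodic N (uncovered (smooth_part (primes_upto 4) M) a)"
    by (rule periodic_uncovered) (use N in \<open>auto simp: smooth_part_def\<close>)
  have D: "\<Delta> = avg N (\<lambda>x. of_bool (uncovered (smooth_part (primes_upto 4) M) a x))"
    unfolding assms(4) uncovered_density_def unc by (rule density_eq_avg[OF per N(1)])
  have D0: "0 < \<Delta>" "\<Delta> < 1 / 12" using assms(5) by auto
  \<comment> \<open>The factor \<open>2 * 10 ^ 10\<close> is squeezed from both sides:
    \<open>2 * K * K * ln 2\<close> has to stay below \<open>5.846 * 10 ^ 20 / \<Delta>\<close>, and
    \<open>K\<close> has to reach \<open>2 ^ 36\<close> for every
    \<open>\<Delta> < 1 / 12\<close>.\<close>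
  define K where "K = nat \<lfloor>2 * 10 ^ 10 / sqrt \<Delta>\<rfloor>"
  have sq: "0 < sqrt \<Delta>" "sqrt \<Delta> * sqrt \<Delta> = \<Delta>" using D0 by auto
  have K_le: "real K \<le> 2 * 10 ^ 10 / sqrt \<Delta>" and K_gt: "2 * 10 ^ 10 / sqrt \<Delta> < real K + 1"
    using sq by (auto simp: K_def of_nat_nat)
  \<comment> \<open>The right-hand side is about \<open>0.2910\<close>, and
    \<open>sqrt (1 / 12)\<close> is about \<open>0.2887\<close>.\<close>
  have "sqrt \<Delta> \<le> 2 * 10 ^ 10 / 2 ^ 36"
    using D0 by (intro real_le_lsqrt) (auto simp: power_divide)
  then have "2 ^ 36 \<le> 2 * 10 ^ 10 / sqrt \<Delta>" using sq by (simp add: field_simps)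
  then have "2 ^ 36 < real K + 1" using K_gt by linarith
  then have "real (2 ^ 36) < real (K + 1)" by simp
  then have K36: "2 ^ 36 \<le> K" unfolding of_nat_less_iff by simp
  obtain t where t: "2 ^ t \<le> K" "K < 2 ^ (t + 1)"
    using ex_power_ivl1[of 2 K] K36 by auto
  have "(2::nat) ^ 36 < 2 ^ (t + 1)" using K36 t(2) by linarith
  then have t36: "36 \<le> t" using power_less_imp_less_exp[of "2::nat" 36 "t + 1"] by simp
  have K1: "real K \<ge> 1" using K36 by simp
  have "1 / real K ^ 2 \<le> \<Delta>"
  proof -
    have "2 * 10 ^ 10 / sqrt \<Delta> < 2 * real K" using K_gt K1 by simp
    then have "1 / real K \<le> sqrt \<Delta>" using sq K1 by (simp add: field_simps)
    then have "(1 / real K) ^ 2 \<le> sqrt \<Delta> ^ 2" using K1 by (intro power_mono) auto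
    then show ?thesis using D0 by (simp add: power_divide)
  qed
  then have "1 + 1 / 2 ^ (2 * (K * K)) \<le> (\<Sum>m\<in>M. 1 / real m)"
    unfolding D using reciprocal_sum_ge[where M=M and a=a and N=N and t=t and K=K, OF M cov N(2,1) t36 t] by blast
  moreover have "(\<Sum>m\<in>M. 1 / real m) = (\<Sum>(a, m)\<in>C. 1 / real m)"
    unfolding M_def sum.reindex[OF inj] by (simp add: case_prod_beta)
  moreover have "exp (- (5.846 * 10 ^ 20 - 1.242 * 10 ^ 19 * ln \<Delta>) / \<Delta>) \<le> 1 / 2 ^ (2 * (K * K))"
  proof -
    have "real K * real K \<le> (2 * 10 ^ 10 / sqrt \<Delta>) * (2 * 10 ^ 10 / sqrt \<Delta>)"
      using K_le D0 by (intro mult_mono) auto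
    also have "\<dots> = 4 * 10 ^ 20 / \<Delta>" using sq by simp
    finally have "2 * (real K * real K) * ln 2 \<le> 2 * (4 * 10 ^ 20 / \<Delta>) * (73 / 100)"
      using ln_2_le_73 D0 by (intro mult_mono) auto
    also have "\<dots> \<le> 5.846 * 10 ^ 20 / \<Delta>" using D0 by (simp add: divide_right_mono)
    also have "\<dots> \<le> (5.846 * 10 ^ 20 - 1.242 * 10 ^ 19 * ln \<Delta>) / \<Delta>"
    proof (rule divide_right_mono)
      have "ln \<Delta> \<le> 0" using D0 by simp
      then show "5.846 * 10 ^ 20 \<le> 5.846 * 10 ^ 20 - 1.242 * 10 ^ 19 * ln \<Delta>" by simp
    qed (use D0 in simp)
    finally have "real (2 * (K * K)) * ln 2 \<le> (5.846 * 10 ^ 20 - 1.242 * 10 ^ 19 * ln \<Delta>) / \<Delta>"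
      by simp
    then have "exp (- (5.846 * 10 ^ 20 - 1.242 * 10 ^ 19 * ln \<Delta>) / \<Delta>) \<le> exp (- (real (2 * (K * K)) * ln 2))"
      by (simp only: minus_divide_left[symmetric] exp_le_cancel_iff neg_le_iff_le)
    also have "\<dots> = 1 / 2 ^ (2 * (K * K))" unfolding exp_minus exp_of_nat_mult by (simp add: divide_inverse)
    finally show ?thesis .
  qed
  ultimately show ?thesis by linarith
qed

end
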